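(* Let $(X_t)_{t\ge 0}$ be a positive (i.e. nonnegative) local submartingale. The following are equivalent: (1) the local submartingale $(X_t)$ is of class $(\Sigma)$; (2) there exists an increasing, adapted and continuous process $(C_t)_{t\ge 0}$ such that for every locally bounded Borel function $f$, with $F(x)=\int_0^x f(z)\,dz$, the process $F(C_t)-f(C_t)X_t$ is a local martingale. Moreover, in this case, $(C_t)$ is equal to $(A_t)$, the increasing process of $X$.
   Context: All processes are defined on a filtered probability space $(\Omega,\mathcal{F},(\mathcal{F}_t)_{t\ge0},\mathbb{P})$; "increasing" means nondecreasing. A positive local submartingale $X$ which decomposes as $X_t=N_t+A_t$ is said to be of class $(\Sigma)$ if: (i) $(N_t)$ is a càdlàg local martingale with $N_0=0$; (ii) $(A_t)$ is a continuous increasing process with $A_0=0$; (iii) the measure $(dA_t)$ is carried by the set $\{t: X_t=0\}$. The process $A$ is the increasing process of $X$ in its (Doob–Meyer) decomposition.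
   Formalization: In (2), "local martingale" is taken càdlàg and null at 0 (so X_0 = C_0 = 0 a.s.); otherwise X = 1, C = 0 satisfies (2) but not (1), and C = A + c contradicts C = A. X is assumed to have càdlàg paths. *)

theory Defs
  imports "HOL-Probability.Probability"
begin

text \<open>
  Processes are functions \<^typ>\<open>real \<Rightarrow> 'a \<Rightarrow> real\<close> of which only the values at times
  \<open>t \<ge> 0\<close> are ever used. The filtration is the library's, indexed by the reals; a filtration
  indexed by \<open>[0, \<infinity>)\<close> is the special case \<open>F t = F 0\<close> for \<open>t < 0\<close>. Completeness and
  right-continuity are not assumed.
\<close>

locale filtered_prob_space =
  prob_space M + filtration "space M" F
  for M :: "'a measure" and F :: "real \<Rightarrow> 'a measure" +
  assumes subalgebra_F: "\<And>t. subalgebra M (F t)"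

definition adapted :: "(real \<Rightarrow> 'a measure) \<Rightarrow> (real \<Rightarrow> 'a \<Rightarrow> real) \<Rightarrow> bool" where
  "adapted F Y \<longleftrightarrow> (\<forall>t\<ge>0. Y t \<in> borel_measurable (F t))"

definition cadlag :: "(real \<Rightarrow> real) \<Rightarrow> bool" where
  "cadlag y \<longleftrightarrow> (\<forall>t\<ge>0. (y \<longlongrightarrow> y t) (at_right t)) \<and> (\<forall>t>0. \<exists>l. (y \<longlongrightarrow> l) (at_left t))"

definition martingale ::
    "'a measure \<Rightarrow> (real \<Rightarrow> 'a measure) \<Rightarrow> (real \<Rightarrow> 'a \<Rightarrow> real) \<Rightarrow> bool" where
  "martingale M F Y \<longleftrightarrow> adapted F Y \<and> (\<forall>t\<ge>0. integrable M (Y t)) \<and>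
     (\<forall>s t. 0 \<le> s \<and> s \<le> t \<longrightarrow> (AE \<omega> in M. real_cond_exp M (F s) (Y t) \<omega> = Y s \<omega>))"

definition submartingale ::
    "'a measure \<Rightarrow> (real \<Rightarrow> 'a measure) \<Rightarrow> (real \<Rightarrow> 'a \<Rightarrow> real) \<Rightarrow> bool" where
  "submartingale M F Y \<longleftrightarrow> adapted F Y \<and> (\<forall>t\<ge>0. integrable M (Y t)) \<and>
     (\<forall>s t. 0 \<le> s \<and> s \<le> t \<longrightarrow> (AE \<omega> in M. Y s \<omega> \<le> real_cond_exp M (F s) (Y t) \<omega>))"

text \<open>
  Localizing times are finite here, whereas in general they may take the value \<open>\<infinity>\<close>. This makes
  no difference, since a localizing sequence \<open>T n\<close> can be replaced by \<open>min (T n) n\<close>.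
\<close>

definition localizing_sequence ::
    "'a measure \<Rightarrow> (real \<Rightarrow> 'a measure) \<Rightarrow> (nat \<Rightarrow> 'a \<Rightarrow> real) \<Rightarrow> bool" where
  "localizing_sequence M F T \<longleftrightarrow>
     (\<forall>n. stopping_time F (T n) \<and> (\<forall>\<omega>\<in>space M. 0 \<le> T n \<omega>)) \<and>
     (AE \<omega> in M. incseq (\<lambda>n. T n \<omega>) \<and> filterlim (\<lambda>n. T n \<omega>) at_top sequentially)"

text \<open>
  The stopped process is cut off on \<open>{T = 0}\<close>, the usual device by which the initial value
  of a local (sub)martingale need not be integrable.
\<close>

definition stopped ::
    "('a \<Rightarrow> real) \<Rightarrow> (real \<Rightarrow> 'a \<Rightarrow> real) \<Rightarrow> real \<Rightarrow> 'a \<Rightarrow> real" where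
  "stopped T Y = (\<lambda>t \<omega>. if 0 < T \<omega> then Y (min (T \<omega>) t) \<omega> else 0)"

definition local_martingale ::
    "'a measure \<Rightarrow> (real \<Rightarrow> 'a measure) \<Rightarrow> (real \<Rightarrow> 'a \<Rightarrow> real) \<Rightarrow> bool" where
  "local_martingale M F Y \<longleftrightarrow> adapted F Y \<and> (AE \<omega> in M. cadlag (\<lambda>t. Y t \<omega>)) \<and>
     (\<exists>T. localizing_sequence M F T \<and> (\<forall>n. martingale M F (stopped (T n) Y)))"

definition local_submartingale ::
    "'a measure \<Rightarrow> (real \<Rightarrow> 'a measure) \<Rightarrow> (real \<Rightarrow> 'a \<Rightarrow> real) \<Rightarrow> bool" where
  "local_submartingale M F Y \<longleftrightarrow> adapted F Y \<and> (AE \<omega> in M. cadlag (\<lambda>t. Y t \<omega>)) \<and>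
     (\<exists>T. localizing_sequence M F T \<and> (\<forall>n. submartingale M F (stopped (T n) Y)))"

definition local_martingale_null_at_0 ::
    "'a measure \<Rightarrow> (real \<Rightarrow> 'a measure) \<Rightarrow> (real \<Rightarrow> 'a \<Rightarrow> real) \<Rightarrow> bool" where
  "local_martingale_null_at_0 M F Y \<longleftrightarrow> local_martingale M F Y \<and> (AE \<omega> in M. Y 0 \<omega> = 0)"

definition continuous_increasing_process ::
    "'a measure \<Rightarrow> (real \<Rightarrow> 'a measure) \<Rightarrow> (real \<Rightarrow> 'a \<Rightarrow> real) \<Rightarrow> bool" where
  "continuous_increasing_process M F A \<longleftrightarrow> adapted F A \<and>
     (\<forall>\<omega>\<in>space M. continuous_on {0..} (\<lambda>t. A t \<omega>) \<and> mono_on {0..} (\<lambda>t. A t \<omega>))"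

definition Doob_Meyer_decomposition ::
    "'a measure \<Rightarrow> (real \<Rightarrow> 'a measure) \<Rightarrow> (real \<Rightarrow> 'a \<Rightarrow> real) \<Rightarrow>
     (real \<Rightarrow> 'a \<Rightarrow> real) \<Rightarrow> (real \<Rightarrow> 'a \<Rightarrow> real) \<Rightarrow> bool" where
  "Doob_Meyer_decomposition M F X N A \<longleftrightarrow>
     (AE \<omega> in M. \<forall>t\<ge>0. X t \<omega> = N t \<omega> + A t \<omega>) \<and>
     local_martingale_null_at_0 M F N \<and> (\<forall>\<omega>\<in>space M. cadlag (\<lambda>t. N t \<omega>)) \<and>
     continuous_increasing_process M F A \<and> (AE \<omega> in M. A 0 \<omega> = 0)"

text \<open>
  The Stieltjes measure \<open>dA\<close> of a path on \<open>[0, \<infinity>)\<close>: the path is extended by its value at 0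
  to negative times, which therefore carry no mass.
\<close>

definition path_measure :: "(real \<Rightarrow> real) \<Rightarrow> real measure" where
  "path_measure a = interval_measure (\<lambda>t. a (max 0 t))"

definition class_Sigma ::
    "'a measure \<Rightarrow> (real \<Rightarrow> 'a measure) \<Rightarrow> (real \<Rightarrow> 'a \<Rightarrow> real) \<Rightarrow> bool" where
  "class_Sigma M F X \<longleftrightarrow>
     local_submartingale M F X \<and> (AE \<omega> in M. \<forall>t\<ge>0. 0 \<le> X t \<omega>) \<and>
     (\<exists>N A. Doob_Meyer_decomposition M F X N A \<and>
        (AE \<omega> in M. AE t in path_measure (\<lambda>t. A t \<omega>). 0 \<le> t \<longrightarrow> X t \<omega> = 0))"

definition locally_bounded :: "(real \<Rightarrow> real) \<Rightarrow> bool" where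
  "locally_bounded f \<longleftrightarrow> (\<forall>K. compact K \<longrightarrow> bounded (f ` K))"

text \<open>
  The local martingales below are null at 0, as is the martingale part of a process of class
  \<open>\<Sigma>\<close>. If nonzero initial values were allowed, then \<open>X = 1\<close>, \<open>C = 0\<close> would have the property
  although \<open>X\<close> is not of class \<open>\<Sigma>\<close>, and \<open>C\<close> would be determined only up to its initial value.
  The requirement forces \<open>X 0 = C 0 = 0\<close> almost surely, by taking \<open>f = (\<lambda>z. 1)\<close> and
  \<open>f = (\<lambda>z. z)\<close>; conversely it is automatic if \<open>X 0 = C 0 = 0\<close>.
\<close>

definition martingale_transform_property ::
    "'a measure \<Rightarrow> (real \<Rightarrow> 'a measure) \<Rightarrow> (real \<Rightarrow> 'a \<Rightarrow> real) \<Rightarrow> (real \<Rightarrow> 'a \<Rightarrow> real) \<Rightarrow> bool" where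
  "martingale_transform_property M F X C \<longleftrightarrow>
     (\<forall>f \<in> borel_measurable borel. locally_bounded f \<longrightarrow>
        local_martingale_null_at_0 M F
          (\<lambda>t \<omega>. (LBINT z=0..C t \<omega>. f z) - f (C t \<omega>) * X t \<omega>))"

end

theory Submission
  imports Defs
begin

text \<open>
  Both directions avoid stochastic integration. Suppose that \<open>X = N + A\<close> is of class \<open>\<Sigma>\<close> and let
  \<open>R c\<close> be the last time at which \<open>A \<le> c\<close>. Since \<open>A\<close> increases immediately after \<open>R c\<close>, the process
  \<open>X\<close> vanishes there, so for \<open>f = indicator {..c}\<close> the transform \<open>min A c - f(A) X\<close> is
  \<open>- N\<close> stopped at \<open>R c\<close>, hence a martingale after localization. As \<open>{R c < t} = {c < A t}\<close>, this uses
  optional stopping for times which are only optional, not stopping times, of the raw filtration.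
  A monotone class argument extends the martingale property to bounded Borel functions \<open>f\<close>.

  Conversely, \<open>f = 1\<close> and \<open>f = id\<close> show that \<open>C - X\<close> is a local martingale with \<open>C 0 = 0\<close>. For
  \<open>f = indicator {q<..}\<close>, right-continuity of the transform forces \<open>X\<close> to vanish at \<open>R q\<close>, and
  letting \<open>q\<close> range over the rationals shows that \<open>dC\<close> is carried by \<open>{X = 0}\<close>. Finally \<open>C = A\<close>
  because a continuous local martingale of finite variation that is null at 0 vanishes.
\<close>

section \<open>Convergence of integrals under a bound on excesses\<close>

text \<open>Formally the transform is the stochastic integral of \<open>- f(A)\<close> with respect
  to \<open>N\<close>, because \<open>X\<close> vanishes wherever \<open>f(A)\<close> varies. For
  \<open>f = indicator {..c}\<close> such an integral is mere stopping, and the half-lines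
  \<open>{..c}\<close> form an intersection-stable generator of the Borel sets; hence the choice of
  generators.

  The obstacle is the raw filtration. A process that equals a martingale almost everywhere need not
  be adapted, and a martingale stopped at an optional time is a priori adapted only to the right
  limits of the filtration. Adaptedness of stopped processes and of transforms is therefore read off
  formulas valid for every \<omega>, and enters the martingale lemmas as a separate hypothesis. For
  the same reason regularity of paths is required at every \<omega> where values at random times
  have to be measurable, and only almost everywhere where integrals alone matter.\<close>

lemma (in prob_space) integral_le_of_AE_tendsto:
  fixes f :: "nat \<Rightarrow> 'a \<Rightarrow> real"
  assumes f: "\<And>m. integrable M (f m)" "\<And>m \<omega>. 0 \<le> f m \<omega>"
    and g[measurable]: "g \<in> borel_measurable M" and g0: "\<And>\<omega>. 0 \<le> g \<omega>"
    and lim: "AE \<omega> in M. (\<lambda>m. f m \<omega>) \<longlonglongrightarrow> g \<omega>"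
    and bnd: "\<And>m. (\<integral>\<omega>. f m \<omega> \<partial>M) \<le> c"
  shows "integrable M g" "(\<integral>\<omega>. g \<omega> \<partial>M) \<le> c"
proof -
  have [measurable]: "f m \<in> borel_measurable M" for m using f(1) by auto
  have c0: "0 \<le> c"
    by (rule order_trans[OF Bochner_Integration.integral_nonneg bnd[of 0]]) (rule f(2))
  have "(\<integral>\<^sup>+\<omega>. ennreal (g \<omega>) \<partial>M) = (\<integral>\<^sup>+\<omega>. liminf (\<lambda>m. ennreal (f m \<omega>)) \<partial>M)"
  proof (rule nn_integral_cong_AE)
    show "AE \<omega> in M. ennreal (g \<omega>) = liminf (\<lambda>m. ennreal (f m \<omega>))"
      using lim
    proof eventually_elim
      case (elim \<omega>)
      then have "(\<lambda>m. ennreal (f m \<omega>)) \<longlonglongrightarrow> ennreal (g \<omega>)" by (rule tendsto_ennrealI)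
      then show ?case by (intro lim_imp_Liminf[symmetric]) auto
    qed
  qed
  also have "\<dots> \<le> liminf (\<lambda>m. \<integral>\<^sup>+\<omega>. ennreal (f m \<omega>) \<partial>M)"
    by (rule nn_integral_liminf) auto
  also have "\<dots> \<le> liminf (\<lambda>m::nat. ennreal c)"
    using f bnd by (intro Liminf_mono always_eventually allI) (simp add: nn_integral_eq_integral c0)
  also have "\<dots> = ennreal c" by (simp add: Liminf_const)
  finally have le: "(\<integral>\<^sup>+\<omega>. ennreal (g \<omega>) \<partial>M) \<le> ennreal c" .
  show int: "integrable M g"
    using le g0 by (intro integrableI_nonneg) (auto intro: le_less_trans)
  show "(\<integral>\<omega>. g \<omega> \<partial>M) \<le> c"
    using le c0 g0 by (simp add: nn_integral_eq_integral[OF int] )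
qed

text \<open>The integral of \<open>excess k\<close> measures the tail beyond \<open>k\<close>, like
  the integral of the modulus over the set where it exceeds \<open>k\<close>. This variant is
  continuous, so Fatou's lemma applies to it, and convex, so its expectation grows along
  martingales.\<close>

definition excess :: "real \<Rightarrow> real \<Rightarrow> real" where
  "excess k y = max 0 (\<bar>y\<bar> - k)"

lemma excess_nonneg[simp]: "0 \<le> excess k y"
  by (simp add: excess_def)

lemma excess_0: "excess 0 y = \<bar>y\<bar>"
  by (simp add: excess_def)

lemma excess_le_abs: "0 \<le> k \<Longrightarrow> excess k y \<le> \<bar>y\<bar>"
  by (simp add: excess_def)

lemma borel_measurable_excess[measurable]: "excess k \<in> borel_measurable borel"
  unfolding excess_def by measurable

lemma integrable_excess:
  "integrable M f \<Longrightarrow> 0 \<le> k \<Longrightarrow> integrable M (\<lambda>\<omega>. excess k (f \<omega>))"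
  by (rule Bochner_Integration.integrable_bound[where f=f]) (auto simp: excess_le_abs)

lemma continuous_excess: "isCont (excess k) y"
  unfolding excess_def by (intro continuous_intros)

text \<open>
  The bound on the excess integrals is uniform integrability of \<open>f\<close> in disguise; this
  is a Vitali convergence theorem.
\<close>

lemma (in prob_space) set_integral_tendsto_of_excess_le:
  fixes f :: "nat \<Rightarrow> 'a \<Rightarrow> real"
  assumes f: "\<And>m. integrable M (f m)" and g[measurable]: "g \<in> borel_measurable M"
    and lim: "AE \<omega> in M. (\<lambda>m. f m \<omega>) \<longlonglongrightarrow> g \<omega>"
    and \<xi>: "integrable M \<xi>"
    and bnd: "\<And>m k. 0 \<le> k \<Longrightarrow> (\<integral>\<omega>. excess k (f m \<omega>) \<partial>M) \<le> (\<integral>\<omega>. excess k (\<xi> \<omega>) \<partial>M)"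
  shows "integrable M g"
    and "G \<in> events \<Longrightarrow> (\<lambda>m. \<integral>\<omega>\<in>G. f m \<omega> \<partial>M) \<longlonglongrightarrow> (\<integral>\<omega>\<in>G. g \<omega> \<partial>M)"
proof -
  have [measurable]: "f m \<in> borel_measurable M" for m using f(1) by auto
  have [measurable]: "\<xi> \<in> borel_measurable M" using \<xi> by auto
  have bndg: "(\<integral>\<omega>. excess k (g \<omega>) \<partial>M) \<le> (\<integral>\<omega>. excess k (\<xi> \<omega>) \<partial>M)"
    and intg: "integrable M (\<lambda>\<omega>. excess k (g \<omega>))" if k: "0 \<le> k" for k
  proof -
    have "AE \<omega> in M. (\<lambda>m. excess k (f m \<omega>)) \<longlonglongrightarrow> excess k (g \<omega>)"
      using lim by eventually_elim (rule isCont_tendsto_compose[OF continuous_excess])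
    note * = integral_le_of_AE_tendsto[OF integrable_excess[OF f k] _ _ _ this bnd[OF k]]
    show "(\<integral>\<omega>. excess k (g \<omega>) \<partial>M) \<le> (\<integral>\<omega>. excess k (\<xi> \<omega>) \<partial>M)"
      "integrable M (\<lambda>\<omega>. excess k (g \<omega>))"
      by (rule *; simp)+
  qed
  \<comment> \<open>\<open>excess 0\<close> is the absolute value, so the case \<open>k = 0\<close>
    is integrability itself.\<close>
  show g': "integrable M g"
    using intg[of 0] integrable_iff_bounded[of M g] by (simp add: excess_0 integrable_abs_iff)
  have eps: "((\<lambda>k. \<integral>\<omega>. excess (real k) (\<xi> \<omega>) \<partial>M) \<longlongrightarrow> (\<integral>\<omega>. 0 \<partial>M)) sequentially"
  proof (rule integral_dominated_convergence[where w="\<lambda>\<omega>. \<bar>\<xi> \<omega>\<bar>"])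
    show "AE \<omega> in M. (\<lambda>k. excess (real k) (\<xi> \<omega>)) \<longlonglongrightarrow> 0"
    proof (rule AE_I2)
      fix \<omega>
      have "\<forall>\<^sub>F k in sequentially. excess (real k) (\<xi> \<omega>) = 0"
        using eventually_ge_at_top[of "nat \<lceil>\<bar>\<xi> \<omega>\<bar>\<rceil>"]
      proof eventually_elim
        case (elim k)
        then have "\<bar>\<xi> \<omega>\<bar> \<le> real k" by linarith
        then show ?case by (simp add: excess_def)
      qed
      then show "(\<lambda>k. excess (real k) (\<xi> \<omega>)) \<longlonglongrightarrow> 0" by (rule tendsto_eventually)
    qed
  qed (use \<xi> in \<open>auto simp: excess_le_abs\<close>)
  assume G: "G \<in> events"
  show "(\<lambda>m. \<integral>\<omega>\<in>G. f m \<omega> \<partial>M) \<longlonglongrightarrow> (\<integral>\<omega>\<in>G. g \<omega> \<partial>M)"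
  proof (rule LIMSEQ_I)
    fix e :: real assume e: "0 < e"
    obtain k :: nat where k: "(\<integral>\<omega>. excess (real k) (\<xi> \<omega>) \<partial>M) < e / 3"
      using order_tendstoD(2)[OF eps, of "e/3"] e by (auto simp: eventually_sequentially)
    \<comment> \<open>Truncation to \<open>[-k, k]\<close>. Dominated convergence handles the
      truncated functions, and the truncation error has modulus exactly \<open>excess k y\<close>;
      the errors for \<open>f m\<close>, for \<open>g\<close> and for the truncated integrals
      account for the three parts \<open>e / 3\<close>.\<close>
    define c where "c y = max (- real k) (min (real k) y)" for y
    have cm[measurable]: "c \<in> borel_measurable borel" unfolding c_def by measurable
    have c_abs: "\<bar>c y\<bar> \<le> real k" for y by (auto simp: c_def)
    have diff: "\<bar>y - c y\<bar> = excess (real k) y" for y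
      by (auto simp: c_def excess_def)
    have c_int: "integrable M (\<lambda>\<omega>. c (h \<omega>))" if [measurable]: "h \<in> borel_measurable M" for h
      by (rule integrable_const_bound[where B="real k"]) (auto simp: c_abs)
    have "(\<lambda>m. \<integral>\<omega>. indicator G \<omega> * c (f m \<omega>) \<partial>M) \<longlonglongrightarrow> (\<integral>\<omega>. indicator G \<omega> * c (g \<omega>) \<partial>M)"
    proof (rule integral_dominated_convergence[where w="\<lambda>_. real k"])
      show "AE \<omega> in M. (\<lambda>m. indicator G \<omega> * c (f m \<omega>)) \<longlonglongrightarrow> indicator G \<omega> * c (g \<omega>)"
        using lim unfolding c_def by eventually_elim (intro tendsto_intros)
      show "AE \<omega> in M. norm (indicator G \<omega> * c (f m \<omega>)) \<le> real k" for m
        using c_abs by (auto simp: indicator_def)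
    qed (use G in auto)
    then obtain m0 where m0: "\<And>m. m \<ge> m0 \<Longrightarrow>
        \<bar>(\<integral>\<omega>. indicator G \<omega> * c (f m \<omega>) \<partial>M) - (\<integral>\<omega>. indicator G \<omega> * c (g \<omega>) \<partial>M)\<bar> < e / 3"
      using LIMSEQ_D[of _ _ "e/3"] e by fastforce
    have near: "\<bar>(\<integral>\<omega>\<in>G. h \<omega> \<partial>M) - (\<integral>\<omega>. indicator G \<omega> * c (h \<omega>) \<partial>M)\<bar> \<le> (\<integral>\<omega>. excess (real k) (h \<omega>) \<partial>M)"
      if h: "integrable M h" for h
    proof -
      have [measurable]: "h \<in> borel_measurable M" using h by auto
      have i1: "integrable M (\<lambda>\<omega>. indicator G \<omega> * h \<omega>)" "integrable M (\<lambda>\<omega>. indicator G \<omega> * c (h \<omega>))"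
        using integrable_mult_indicator[OF G h] integrable_mult_indicator[OF G c_int[of h]] by auto
      have "(\<integral>\<omega>\<in>G. h \<omega> \<partial>M) - (\<integral>\<omega>. indicator G \<omega> * c (h \<omega>) \<partial>M)
          = (\<integral>\<omega>. indicator G \<omega> * h \<omega> - indicator G \<omega> * c (h \<omega>) \<partial>M)"
        using i1 by (simp add: set_lebesgue_integral_def)
      also have "\<bar>\<dots>\<bar> \<le> (\<integral>\<omega>. \<bar>indicator G \<omega> * h \<omega> - indicator G \<omega> * c (h \<omega>)\<bar> \<partial>M)"
        by (rule integral_abs_bound)
      also have "\<dots> \<le> (\<integral>\<omega>. excess (real k) (h \<omega>) \<partial>M)"
        using i1 integrable_excess[OF h, of "real k"]
        by (intro integral_mono) (auto simp: diff indicator_def)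
      finally show ?thesis .
    qed
    show "\<exists>m0. \<forall>m\<ge>m0. norm ((\<integral>\<omega>\<in>G. f m \<omega> \<partial>M) - (\<integral>\<omega>\<in>G. g \<omega> \<partial>M)) < e"
    proof (intro exI allI impI)
      fix m assume "m \<ge> m0"
      from m0[OF this] near[OF f[of m]] near[OF g'] bnd[of "real k" m] bndg[of "real k"] k
      show "norm ((\<integral>\<omega>\<in>G. f m \<omega> \<partial>M) - (\<integral>\<omega>\<in>G. g \<omega> \<partial>M)) < e"
        unfolding real_norm_def by linarith
    qed
  qed
qed

section \<open>Approximation of a time from the right on a uniform grid\<close>

definition grid :: "real \<Rightarrow> real \<Rightarrow> nat \<Rightarrow> nat \<Rightarrow> real" where
  "grid s t m k = s + real k * (t - s) / real m"

text \<open>The inequality is strict because for an optional time \<open>R\<close> only the events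
  \<open>{R < u}\<close> are known to belong to \<open>F u\<close>. The alternative
  \<open>k = m\<close> sends all late times to the last grid point, so that a least index always
  exists.\<close>

definition next_index :: "real \<Rightarrow> real \<Rightarrow> nat \<Rightarrow> real \<Rightarrow> nat" where
  "next_index s t m r = (LEAST k. k = m \<or> r < grid s t m k)"

definition next_point :: "real \<Rightarrow> real \<Rightarrow> nat \<Rightarrow> real \<Rightarrow> real" where
  "next_point s t m r = grid s t m (next_index s t m r)"

lemma grid_0 [simp]: "grid s t m 0 = s"
  by (simp add: grid_def)

lemma grid_last [simp]: "0 < m \<Longrightarrow> grid s t m m = t"
  by (simp add: grid_def)

lemma grid_mono: "s \<le> t \<Longrightarrow> j \<le> k \<Longrightarrow> grid s t m j \<le> grid s t m k"
  by (auto simp: grid_def intro!: divide_right_mono mult_right_mono)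

lemma grid_ge: "s \<le> t \<Longrightarrow> s \<le> grid s t m k"
  using grid_mono[of s t 0 k m] by simp

lemma grid_le: "s \<le> t \<Longrightarrow> k \<le> m \<Longrightarrow> 0 < m \<Longrightarrow> grid s t m k \<le> t"
  using grid_mono[of s t k m m] by simp

lemma grid_Suc: "grid s t m (Suc k) = grid s t m k + (t - s) / real m"
  by (simp add: grid_def distrib_right add_divide_distrib)

lemma next_index_le: "next_index s t m r \<le> m"
  unfolding next_index_def by (rule Least_le) simp

lemma next_index_eq_iff:
  "next_index s t m r = k \<longleftrightarrow> (k = m \<or> r < grid s t m k) \<and> (\<forall>j<k. j \<noteq> m \<and> grid s t m j \<le> r)"
proof
  assume "next_index s t m r = k"
  then have k: "k = (LEAST k. k = m \<or> r < grid s t m k)" by (simp add: next_index_def)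
  show "(k = m \<or> r < grid s t m k) \<and> (\<forall>j<k. j \<noteq> m \<and> grid s t m j \<le> r)"
  proof
    show "k = m \<or> r < grid s t m k" unfolding k by (rule LeastI_ex) auto
    show "\<forall>j<k. j \<noteq> m \<and> grid s t m j \<le> r" unfolding k by (auto dest!: not_less_Least)
  qed
next
  assume k: "(k = m \<or> r < grid s t m k) \<and> (\<forall>j<k. j \<noteq> m \<and> grid s t m j \<le> r)"
  show "next_index s t m r = k"
    unfolding next_index_def by (rule Least_equality) (use k in \<open>auto intro: leI\<close>)
qed

lemma next_point_bounds:
  assumes "s \<le> t" "0 < m" "s \<le> r"
  shows "min r t \<le> next_point s t m r" "next_point s t m r \<le> min r t + (t - s) / real m"
proof -
  define k where "k = next_index s t m r"
  have k: "k = m \<or> r < grid s t m k" "\<And>j. j < k \<Longrightarrow> j \<noteq> m \<and> grid s t m j \<le> r"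
    using next_index_eq_iff[of s t m r k] k_def by auto
  show "min r t \<le> next_point s t m r"
    unfolding next_point_def k_def[symmetric] using k(1) assms by auto
  have "k \<noteq> 0" using k(1) assms by (metis grid_0 less_le_not_le not_gr_zero)
  then obtain j where j: "k = Suc j" by (cases k) auto
  have km: "k \<le> m" by (simp add: k_def next_index_le)
  have "grid s t m j \<le> r" "grid s t m j \<le> t" using k(2)[of j] j km assms by (auto intro!: grid_le)
  then show "next_point s t m r \<le> min r t + (t - s) / real m"
    unfolding next_point_def k_def[symmetric] j grid_Suc by simp
qed

lemma next_point_less:
  assumes "r < s" "0 < m"
  shows "next_point s t m r = s"
proof -
  have "next_index s t m r = 0" using assms by (simp add: next_index_eq_iff)
  then show ?thesis by (simp add: next_point_def)
qed

text \<open>The grid point never lies to the left of the limit and exceeds it by at most one mesh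
  width, so right-continuity of \<open>y\<close> is enough. Times before \<open>s\<close> are moved
  to \<open>s\<close>, which is the origin of the \<open>max\<close>.\<close>

lemma next_point_tendsto:
  assumes st: "s \<le> t" and y: "\<And>u. s \<le> u \<Longrightarrow> u \<le> t \<Longrightarrow> (y \<longlongrightarrow> y u) (at_right u)"
  shows "(\<lambda>m. y (next_point s t (Suc m) r)) \<longlonglongrightarrow> y (max s (min r t))"
proof (cases "r < s")
  case True
  with st have "next_point s t (Suc m) r = max s (min r t)" for m by (simp add: next_point_less)
  then show ?thesis by simp
next
  case False
  define x where "x = min r t"
  have x: "s \<le> x" "x \<le> t" using False st by (auto simp: x_def)
  have b: "x \<le> next_point s t (Suc m) r" "next_point s t (Suc m) r \<le> x + (t - s) / real (Suc m)" for m
    using next_point_bounds[of s t "Suc m" r] False st unfolding x_def by auto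
  have "(\<lambda>m. x + (t - s) * inverse (real (Suc m))) \<longlonglongrightarrow> x + (t - s) * 0"
    by (intro tendsto_intros LIMSEQ_inverse_real_of_nat)
  then have up: "(\<lambda>m. x + (t - s) / real (Suc m)) \<longlonglongrightarrow> x" by (simp add: divide_inverse)
  have "(\<lambda>m. next_point s t (Suc m) r) \<longlonglongrightarrow> x"
    by (rule tendsto_sandwich[OF _ _ tendsto_const up]) (use b in auto)
  moreover have "(y \<longlongrightarrow> y x) (at x within {x..})"
    using y[OF x] by (simp add: at_within_Ici_at_right)
  then have "continuous (at x within {x..}) y" by (simp add: continuous_within)
  ultimately have "(\<lambda>m. y (next_point s t (Suc m) r)) \<longlonglongrightarrow> y x"
    using b(1) by (auto simp: continuous_within_sequentially o_def)
  then show ?thesis using x by (simp add: x_def max_absorb2)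
qed

section \<open>Martingales and optional stopping\<close>

context filtered_prob_space
begin

lemma sets_F_subset: "G \<in> sets (F t) \<Longrightarrow> G \<in> events"
  using subalgebra_F[of t] by (auto simp: subalgebra_def)

lemma measurable_F: "f \<in> borel_measurable (F t) \<Longrightarrow> f \<in> borel_measurable M"
  by (rule measurable_from_subalg[OF subalgebra_F])

lemma measurable_F_mono: "s \<le> t \<Longrightarrow> f \<in> borel_measurable (F s) \<Longrightarrow> f \<in> borel_measurable (F t)"
  using sets_F_mono[of s t] by (auto simp: measurable_def space_F)

lemma adaptedD: "adapted F Y \<Longrightarrow> 0 \<le> t \<Longrightarrow> Y t \<in> borel_measurable (F t)"
  by (simp add: adapted_def)

lemma sigma_finite_F: "sigma_finite_subalgebra M (F t)"
proof -
  interpret finite_measure_subalgebra M "F t"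
    by unfold_locales (rule subalgebra_F)
  show ?thesis by unfold_locales
qed

lemma set_integral_cond_exp:
  assumes f: "integrable M f" and G: "G \<in> sets (F s)"
  shows "(\<integral>\<omega>\<in>G. real_cond_exp M (F s) f \<omega> \<partial>M) = (\<integral>\<omega>\<in>G. f \<omega> \<partial>M)"
proof -
  interpret sigma_finite_subalgebra M "F s" by (rule sigma_finite_F)
  have "(\<integral>\<omega>. indicator G \<omega> * real_cond_exp M (F s) f \<omega> \<partial>M) = (\<integral>\<omega>. indicator G \<omega> * f \<omega> \<partial>M)"
    using f G integrable_mult_indicator[OF sets_F_subset[OF G] f]
    by (intro real_cond_exp_intg) auto
  then show ?thesis by (simp add: set_lebesgue_integral_def)
qed

text \<open>Testing against sets of \<open>F s\<close> turns sums, partitions and limits of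
  martingales into statements about integrals, with no versions of conditional expectations to
  handle.\<close>

lemma martingale_iff:
  "martingale M F Y \<longleftrightarrow> adapted F Y \<and> (\<forall>t\<ge>0. integrable M (Y t)) \<and>
     (\<forall>s t. \<forall>G\<in>sets (F s). 0 \<le> s \<longrightarrow> s \<le> t \<longrightarrow> (\<integral>\<omega>\<in>G. Y t \<omega> \<partial>M) = (\<integral>\<omega>\<in>G. Y s \<omega> \<partial>M))"
    (is "?L \<longleftrightarrow> ?R")
proof
  assume L: ?L
  then have int: "\<And>t. 0 \<le> t \<Longrightarrow> integrable M (Y t)" by (auto simp: martingale_def)
  have "(\<integral>\<omega>\<in>G. Y t \<omega> \<partial>M) = (\<integral>\<omega>\<in>G. Y s \<omega> \<partial>M)"
    if "G \<in> sets (F s)" "0 \<le> s" "s \<le> t" for s t G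
  proof -
    have AE: "AE \<omega> in M. real_cond_exp M (F s) (Y t) \<omega> = Y s \<omega>"
      using L that by (auto simp: martingale_def)
    have [measurable]: "Y s \<in> borel_measurable M" "G \<in> events"
      using int[OF that(2)] sets_F_subset[OF that(1)] by auto
    have "(\<integral>\<omega>\<in>G. Y t \<omega> \<partial>M) = (\<integral>\<omega>\<in>G. real_cond_exp M (F s) (Y t) \<omega> \<partial>M)"
      using set_integral_cond_exp[of "Y t" G s] int that by simp
    also have "\<dots> = (\<integral>\<omega>\<in>G. Y s \<omega> \<partial>M)"
      unfolding set_lebesgue_integral_def using AE by (intro integral_cong_AE) auto
    finally show ?thesis .
  qed
  then show ?R using L int unfolding martingale_def by blast
next
  assume R: ?R
  have "AE \<omega> in M. real_cond_exp M (F s) (Y t) \<omega> = Y s \<omega>" if "0 \<le> s" "s \<le> t" for s t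
  proof -
    interpret sigma_finite_subalgebra M "F s" by (rule sigma_finite_F)
    show ?thesis
    proof (rule real_cond_exp_charact)
      show "(\<integral>\<omega>\<in>G. Y t \<omega> \<partial>M) = (\<integral>\<omega>\<in>G. Y s \<omega> \<partial>M)" if "G \<in> sets (F s)" for G
        using R \<open>0 \<le> s\<close> \<open>s \<le> t\<close> that by blast
      show "integrable M (Y t)" "integrable M (Y s)" using R \<open>0 \<le> s\<close> \<open>s \<le> t\<close> by simp_all
      show "Y s \<in> borel_measurable (F s)" using R \<open>0 \<le> s\<close> by (simp add: adapted_def)
    qed
  qed
  then show ?L using R by (simp add: martingale_def)
qed

lemma martingaleD:
  assumes "martingale M F Y"
  shows "adapted F Y" "\<And>t. 0 \<le> t \<Longrightarrow> integrable M (Y t)"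
    "\<And>s t G. G \<in> sets (F s) \<Longrightarrow> 0 \<le> s \<Longrightarrow> s \<le> t \<Longrightarrow> (\<integral>\<omega>\<in>G. Y t \<omega> \<partial>M) = (\<integral>\<omega>\<in>G. Y s \<omega> \<partial>M)"
  using assms unfolding martingale_iff by blast+

lemma martingale_integral_mult:
  assumes Y: "martingale M F Y" and st: "0 \<le> s" "s \<le> t"
    and h: "h \<in> borel_measurable (F s)" "\<And>\<omega>. \<bar>h \<omega>\<bar> \<le> c"
  shows "(\<integral>\<omega>. h \<omega> * Y t \<omega> \<partial>M) = (\<integral>\<omega>. h \<omega> * Y s \<omega> \<partial>M)"
    and "0 \<le> u \<Longrightarrow> integrable M (\<lambda>\<omega>. h \<omega> * Y u \<omega>)"
proof -
  interpret sigma_finite_subalgebra M "F s" by (rule sigma_finite_F)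
  have hm[measurable]: "h \<in> borel_measurable M" using h(1) by (rule measurable_F)
  have int: "integrable M (\<lambda>\<omega>. h \<omega> * Y u \<omega>)" if "0 \<le> u" for u
  proof (rule Bochner_Integration.integrable_bound)
    show "integrable M (\<lambda>\<omega>. c * Y u \<omega>)" using martingaleD(2)[OF Y that] by simp
    show "(\<lambda>\<omega>. h \<omega> * Y u \<omega>) \<in> borel_measurable M"
      using martingaleD(2)[OF Y that] by measurable
    have "0 \<le> c" using h(2)[of undefined] by linarith
    then show "AE \<omega> in M. norm (h \<omega> * Y u \<omega>) \<le> norm (c * Y u \<omega>)"
      using h(2) by (auto simp: abs_mult intro!: mult_right_mono)
  qed
  then show "0 \<le> u \<Longrightarrow> integrable M (\<lambda>\<omega>. h \<omega> * Y u \<omega>)" .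
  have [measurable]: "Y s \<in> borel_measurable M" "Y t \<in> borel_measurable M"
    using martingaleD(2)[OF Y] st by auto
  have AE: "AE \<omega> in M. real_cond_exp M (F s) (Y t) \<omega> = Y s \<omega>"
    using Y st by (auto simp: martingale_def)
  have "(\<integral>\<omega>. h \<omega> * Y t \<omega> \<partial>M) = (\<integral>\<omega>. h \<omega> * real_cond_exp M (F s) (Y t) \<omega> \<partial>M)"
    using int[of t] st h by (intro real_cond_exp_intg(2)[symmetric]) auto
  also have "\<dots> = (\<integral>\<omega>. h \<omega> * Y s \<omega> \<partial>M)"
    using AE by (intro integral_cong_AE) auto
  finally show "(\<integral>\<omega>. h \<omega> * Y t \<omega> \<partial>M) = (\<integral>\<omega>. h \<omega> * Y s \<omega> \<partial>M)" .
qed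

lemma martingale_excess_mono:
  assumes Y: "martingale M F Y" and st: "0 \<le> s" "s \<le> t" and E: "E \<in> sets (F s)" and k: "0 \<le> k"
  shows "(\<integral>\<omega>\<in>E. excess k (Y s \<omega>) \<partial>M) \<le> (\<integral>\<omega>\<in>E. excess k (Y t \<omega>) \<partial>M)"
proof -
  text \<open>\<open>h\<close> is a subgradient of the convex function \<^term>\<open>excess k\<close> at \<^term>\<open>Y s\<close>.\<close>
  define h where "h \<omega> = indicator E \<omega> * (sgn (Y s \<omega>) * indicator {k<..} \<bar>Y s \<omega>\<bar>)" for \<omega>
  have [measurable]: "Y s \<in> borel_measurable (F s)" using martingaleD(1)[OF Y] st by (simp add: adapted_def)
  have hm: "h \<in> borel_measurable (F s)" unfolding h_def using E by measurable
  have hb: "\<bar>h \<omega>\<bar> \<le> 1" for \<omega> by (auto simp: h_def indicator_def abs_mult sgn_if)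
  note m = martingale_integral_mult[OF Y st hm hb]
  have ex: "integrable M (\<lambda>\<omega>. indicator E \<omega> * excess k (Y u \<omega>))" if "0 \<le> u" for u
    using integrable_mult_indicator[OF sets_F_subset[OF E] integrable_excess[OF martingaleD(2)[OF Y that] k]]
    by simp
  have "(\<integral>\<omega>. indicator E \<omega> * excess k (Y s \<omega>) \<partial>M) + 0
      = (\<integral>\<omega>. indicator E \<omega> * excess k (Y s \<omega>) + (h \<omega> * Y t \<omega> - h \<omega> * Y s \<omega>) \<partial>M)"
    using ex[OF st(1)] m(1) m(2)[of s] m(2)[of t] st by simp
  also have "\<dots> \<le> (\<integral>\<omega>. indicator E \<omega> * excess k (Y t \<omega>) \<partial>M)"
  proof (rule integral_mono)
    show "integrable M (\<lambda>\<omega>. indicator E \<omega> * excess k (Y s \<omega>) + (h \<omega> * Y t \<omega> - h \<omega> * Y s \<omega>))"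
      using ex[OF st(1)] m(2)[of s] m(2)[of t] st by auto
    show "integrable M (\<lambda>\<omega>. indicator E \<omega> * excess k (Y t \<omega>))" using ex[of t] st by auto
    show "indicator E \<omega> * excess k (Y s \<omega>) + (h \<omega> * Y t \<omega> - h \<omega> * Y s \<omega>)
        \<le> indicator E \<omega> * excess k (Y t \<omega>)" for \<omega>
      using k by (auto simp: h_def indicator_def excess_def sgn_if)
  qed
  finally show ?thesis by (simp add: set_lebesgue_integral_def)
qed

lemma martingale_cong_AE:
  assumes Y: "martingale M F Y" and Z: "adapted F Z"
    and eq: "\<And>t. 0 \<le> t \<Longrightarrow> AE \<omega> in M. Z t \<omega> = Y t \<omega>"
  shows "martingale M F Z"
  unfolding martingale_iff
proof (intro conjI allI ballI impI Z)
  have Zm[measurable]: "Z t \<in> borel_measurable M" if "0 \<le> t" for t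
    using Z that by (auto simp: adapted_def intro: measurable_F)
  have Ym[measurable]: "Y t \<in> borel_measurable M" if "0 \<le> t" for t
    using martingaleD(2)[OF Y that] by auto
  fix t :: real assume t: "0 \<le> t"
  show "integrable M (Z t)"
    using integrable_cong_AE[OF Zm[OF t] Ym[OF t] eq[OF t]] martingaleD(2)[OF Y t] by simp
next
  fix s t G assume G: "G \<in> sets (F s)" and st: "0 \<le> s" "s \<le> (t::real)"
  have *: "(\<integral>\<omega>\<in>G. Z u \<omega> \<partial>M) = (\<integral>\<omega>\<in>G. Y u \<omega> \<partial>M)" if u: "0 \<le> u" for u
  proof -
    have [measurable]: "Z u \<in> borel_measurable M" "Y u \<in> borel_measurable M" "G \<in> events"
      using Z u martingaleD(2)[OF Y u] sets_F_subset[OF G] by (auto simp: adapted_def intro: measurable_F)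
    show ?thesis
      unfolding set_lebesgue_integral_def using eq[OF u] by (intro integral_cong_AE) auto
  qed
  show "(\<integral>\<omega>\<in>G. Z t \<omega> \<partial>M) = (\<integral>\<omega>\<in>G. Z s \<omega> \<partial>M)"
    using *[of s] *[of t] martingaleD(3)[OF Y G st] st by simp
qed

lemma martingale_add:
  assumes Y: "martingale M F Y" and Z: "martingale M F Z"
  shows "martingale M F (\<lambda>t \<omega>. Y t \<omega> + Z t \<omega>)"
proof -
  have "(\<integral>\<omega>\<in>G. Y u \<omega> + Z u \<omega> \<partial>M) = (\<integral>\<omega>\<in>G. Y u \<omega> \<partial>M) + (\<integral>\<omega>\<in>G. Z u \<omega> \<partial>M)"
    if "G \<in> sets (F s)" "0 \<le> u" for s u G
    using integrable_mult_indicator[OF sets_F_subset[OF that(1)] martingaleD(2)[OF Y that(2)]]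
      integrable_mult_indicator[OF sets_F_subset[OF that(1)] martingaleD(2)[OF Z that(2)]]
    by (intro set_integral_add(2)) (auto simp: set_integrable_def)
  note eq = this
  show ?thesis
    unfolding martingale_iff
  proof (intro conjI allI ballI impI)
    show "adapted F (\<lambda>t \<omega>. Y t \<omega> + Z t \<omega>)"
      using martingaleD(1)[OF Y] martingaleD(1)[OF Z]
      by (auto simp: adapted_def intro!: borel_measurable_add)
    show "integrable M (\<lambda>\<omega>. Y t \<omega> + Z t \<omega>)" if "0 \<le> t" for t
      using martingaleD(2)[OF Y that] martingaleD(2)[OF Z that] by simp
    fix s t G assume G: "G \<in> sets (F s)" "0 \<le> s" "s \<le> (t::real)"
    then show "(\<integral>\<omega>\<in>G. Y t \<omega> + Z t \<omega> \<partial>M) = (\<integral>\<omega>\<in>G. Y s \<omega> + Z s \<omega> \<partial>M)"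
      using eq[OF G(1), of t] eq[OF G(1), of s] martingaleD(3)[OF Y G] martingaleD(3)[OF Z G] by simp
  qed
qed

lemma martingale_cmult:
  assumes Y: "martingale M F Y"
  shows "martingale M F (\<lambda>t \<omega>. c * Y t \<omega>)"
proof -
  have "(\<integral>\<omega>\<in>G. c * Y u \<omega> \<partial>M) = c * (\<integral>\<omega>\<in>G. Y u \<omega> \<partial>M)" for u G
    by (simp add: set_lebesgue_integral_def mult.left_commute)
  moreover have "adapted F (\<lambda>t \<omega>. c * Y t \<omega>)"
    using martingaleD(1)[OF Y] by (auto simp: adapted_def)
  ultimately show ?thesis
    using martingaleD(2,3)[OF Y] unfolding martingale_iff by (metis Bochner_Integration.integrable_mult_right)
qed

section \<open>Optional times and optional sampling\<close>

definition optional_upto :: "real \<Rightarrow> ('a \<Rightarrow> real) \<Rightarrow> bool" where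
  "optional_upto t R \<longleftrightarrow> (\<forall>u. 0 \<le> u \<longrightarrow> u \<le> t \<longrightarrow> {\<omega>\<in>space M. R \<omega> < u} \<in> sets (F u))"

lemma optional_upto_stopping_time:
  assumes "stopping_time F T"
  shows "optional_upto t T"
  using stopping_time_less_const[OF assms] by (auto simp: optional_upto_def pred_def space_F)

text \<open>Index \<open>k\<close> means that \<open>R\<close> is below the \<open>k\<close>-th grid
  point but below no earlier one: a Boolean combination of events \<open>{R < u}\<close> with
  \<open>u\<close> up to that point. Thus the discretization of a merely optional time is a stopping
  time on the grid.\<close>

lemma next_index_event:
  assumes st: "0 \<le> s" "s \<le> t" and R: "optional_upto t R" and m: "0 < m"
  shows "{\<omega>\<in>space M. next_index s t m (R \<omega>) = k} \<in> sets (F (grid s t m k))"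
proof (cases "k \<le> m")
  case True
  have ev: "{\<omega>\<in>space M. R \<omega> < grid s t m j} \<in> sets (F (grid s t m k))" if "j \<le> k" for j
  proof -
    have "0 \<le> grid s t m j" "grid s t m j \<le> t"
      using st that True m grid_ge[of s t m j] by (auto intro: grid_le)
    then have "{\<omega>\<in>space M. R \<omega> < grid s t m j} \<in> sets (F (grid s t m j))"
      using R by (auto simp: optional_upto_def)
    then show ?thesis using sets_F_mono[OF grid_mono[OF st(2) that, of m]] by auto
  qed
  let ?A = "\<lambda>j. {\<omega>\<in>space M. R \<omega> < grid s t m j}"
  have "{\<omega>\<in>space M. next_index s t m (R \<omega>) = k} = (if k = m then space M else ?A k) - (\<Union>j\<in>{..<k}. ?A j)"
    unfolding next_index_eq_iff using True by (auto simp: not_less)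
  also have "\<dots> \<in> sets (F (grid s t m k))"
    using ev sets.top[of "F (grid s t m k)"] by (intro sets.Diff sets.finite_UN) (auto simp: space_F)
  finally show ?thesis .
next
  case False
  then have "{\<omega>\<in>space M. next_index s t m (R \<omega>) = k} = {}"
    using next_index_le[of s t m] by auto
  then show ?thesis by (simp only: sets.empty_sets)
qed

lemma next_point_sum:
  "(g :: real \<Rightarrow> real) (next_point s t m r) = (\<Sum>k\<le>m. indicator {r. next_index s t m r = k} r * g (grid s t m k))"
proof -
  have "(\<Sum>k\<le>m. indicator {r. next_index s t m r = k} r * g (grid s t m k))
     = (\<Sum>k\<le>m. if k = next_index s t m r then g (grid s t m k) else 0)"
    by (rule sum.cong) (auto simp: indicator_def)
  then show ?thesis by (simp add: next_index_le next_point_def)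
qed

lemma next_point_measurable:
  assumes Y: "adapted F Y" and st: "0 \<le> s" "s \<le> t" and R: "optional_upto t R" and m: "0 < m"
  shows "(\<lambda>\<omega>. Y (next_point s t m (R \<omega>)) \<omega>) \<in> borel_measurable (F t)"
proof (rule measurable_cong[THEN iffD2])
  show "Y (next_point s t m (R \<omega>)) \<omega> = (\<Sum>k\<le>m. indicator {\<omega>\<in>space M. next_index s t m (R \<omega>) = k} \<omega> * Y (grid s t m k) \<omega>)"
    if "\<omega> \<in> space (F t)" for \<omega>
    using that by (subst next_point_sum[where g="\<lambda>u. Y u \<omega>"]) (auto simp: space_F indicator_def)
  have "(\<lambda>\<omega>. indicator {\<omega>\<in>space M. next_index s t m (R \<omega>) = k} \<omega> * Y (grid s t m k) \<omega>) \<in> borel_measurable (F t)"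
    if k: "k \<le> m" for k
  proof -
    have u: "0 \<le> grid s t m k" "grid s t m k \<le> t" using st k m grid_ge[of s t m k] by (auto intro: grid_le)
    have [measurable]: "Y (grid s t m k) \<in> borel_measurable (F (grid s t m k))"
      "{\<omega>\<in>space M. next_index s t m (R \<omega>) = k} \<in> sets (F (grid s t m k))"
      using Y u next_index_event[OF st R m, of k] by (auto simp: adapted_def)
    show ?thesis by (rule measurable_F_mono[OF u(2)]) measurable
  qed
  then show "(\<lambda>\<omega>. \<Sum>k\<le>m. indicator {\<omega>\<in>space M. next_index s t m (R \<omega>) = k} \<omega> * Y (grid s t m k) \<omega>) \<in> borel_measurable (F t)"
    by (intro borel_measurable_sum) auto
qed

text \<open>Discrete optional sampling. On \<open>E k\<close> the value is \<open>Y (u k)\<close>;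
  since \<open>E k\<close> and \<open>G\<close> belong to \<open>F (u k)\<close>, it may be replaced
  by \<open>Y t\<close> under the integral, and the events \<open>E k\<close> partition the space.
  The same replacement with an inequality yields an excess bound by \<open>Y t\<close> that does not
  depend on \<open>m\<close>.\<close>

lemma martingale_next_point:
  assumes Y: "martingale M F Y" and st: "0 \<le> s" "s \<le> t" and R: "optional_upto t R" and m: "0 < m"
  shows "integrable M (\<lambda>\<omega>. Y (next_point s t m (R \<omega>)) \<omega>)" (is ?A)
    and "G \<in> sets (F s) \<Longrightarrow> (\<integral>\<omega>\<in>G. Y (next_point s t m (R \<omega>)) \<omega> \<partial>M) = (\<integral>\<omega>\<in>G. Y s \<omega> \<partial>M)" (is "_ \<Longrightarrow> ?B")
    and "0 \<le> c \<Longrightarrow> (\<integral>\<omega>. excess c (Y (next_point s t m (R \<omega>)) \<omega>) \<partial>M) \<le> (\<integral>\<omega>. excess c (Y t \<omega>) \<partial>M)" (is "_ \<Longrightarrow> ?C")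
proof -
  define E where "E k = {\<omega>\<in>space M. next_index s t m (R \<omega>) = k}" for k
  define u where "u = grid s t m"
  have u: "0 \<le> u k" "s \<le> u k" "u k \<le> t" if "k \<le> m" for k
    using st that m grid_ge[of s t m k] by (auto simp: u_def intro: grid_le)
  have E: "E k \<in> sets (F (u k))" for k
    using next_index_event[OF st R m] by (simp add: E_def u_def)
  note EM = sets_F_subset[OF E]
  have np: "h (Y (next_point s t m (R \<omega>)) \<omega>) = (\<Sum>k\<le>m. indicator (E k) \<omega> * h (Y (u k) \<omega>))"
    if "\<omega> \<in> space M" for h :: "real \<Rightarrow> real" and \<omega>
    using that by (subst next_point_sum[where g="\<lambda>u. h (Y u \<omega>)"]) (auto simp: E_def u_def indicator_def)
  have np_id: "Y (next_point s t m (R \<omega>)) \<omega> = (\<Sum>k\<le>m. indicator (E k) \<omega> * Y (u k) \<omega>)"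
    if "\<omega> \<in> space M" for \<omega>
    using np[OF that, of "\<lambda>x. x"] .
  have one: "(\<Sum>k\<le>m. indicator (E k) \<omega>) = (1::real)" if "\<omega> \<in> space M" for \<omega>
  proof -
    have "(\<Sum>k\<le>m. indicator (E k) \<omega>) = (\<Sum>k\<le>m. if k = next_index s t m (R \<omega>) then 1 else (0::real))"
      using that by (intro sum.cong) (auto simp: E_def)
    then show ?thesis by (simp add: next_index_le)
  qed
  have intE: "integrable M (\<lambda>\<omega>. indicator (E k) \<omega> * Z \<omega>)" if "integrable M Z" for k and Z :: "'a \<Rightarrow> real"
    using integrable_mult_indicator[OF EM that, of k] by simp
  have intGE: "integrable M (\<lambda>\<omega>. indicator G \<omega> * (indicator (E k) \<omega> * Z \<omega>))"
    if "integrable M Z" "G \<in> events" for k G and Z :: "'a \<Rightarrow> real"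
    using integrable_mult_indicator[OF that(2) intE[OF that(1), of k]] by simp
  show ?A
  proof (subst Bochner_Integration.integrable_cong[OF refl np_id])
    show "integrable M (\<lambda>\<omega>. \<Sum>k\<le>m. indicator (E k) \<omega> * Y (u k) \<omega>)"
      using u by (intro Bochner_Integration.integrable_sum intE martingaleD(2)[OF Y]) auto
  qed auto
  have Yt: "integrable M (Y t)" using martingaleD(2)[OF Y] st by auto
  show ?B if G: "G \<in> sets (F s)"
  proof -
    have GM: "G \<in> events" using G by (rule sets_F_subset)
    have eq: "(\<integral>\<omega>. indicator G \<omega> * (indicator (E k) \<omega> * Y (u k) \<omega>) \<partial>M)
        = (\<integral>\<omega>. indicator G \<omega> * (indicator (E k) \<omega> * Y t \<omega>) \<partial>M)" if k: "k \<le> m" for k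
    proof -
      have "G \<inter> E k \<in> sets (F (u k))" using G sets_F_mono[OF u(2)[OF k]] E by auto
      from martingaleD(3)[OF Y this u(1)[OF k] u(3)[OF k]] show ?thesis
        by (simp add: set_lebesgue_integral_def indicator_inter_arith mult_ac)
    qed
    have "(\<integral>\<omega>\<in>G. Y (next_point s t m (R \<omega>)) \<omega> \<partial>M)
        = (\<integral>\<omega>. (\<Sum>k\<le>m. indicator G \<omega> * (indicator (E k) \<omega> * Y (u k) \<omega>)) \<partial>M)"
      unfolding set_lebesgue_integral_def
      by (intro Bochner_Integration.integral_cong refl) (simp only: np_id sum_distrib_left real_scaleR_def)
    also have "\<dots> = (\<Sum>k\<le>m. \<integral>\<omega>. indicator G \<omega> * (indicator (E k) \<omega> * Y t \<omega>) \<partial>M)"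
      using u by (subst Bochner_Integration.integral_sum) (auto intro!: intGE GM martingaleD(2)[OF Y] sum.cong simp: eq)
    also have "\<dots> = (\<integral>\<omega>. (\<Sum>k\<le>m. indicator G \<omega> * (indicator (E k) \<omega> * Y t \<omega>)) \<partial>M)"
      by (subst Bochner_Integration.integral_sum) (auto intro!: intGE GM Yt)
    also have "\<dots> = (\<integral>\<omega>\<in>G. Y t \<omega> \<partial>M)"
      unfolding set_lebesgue_integral_def
      by (intro Bochner_Integration.integral_cong) (auto simp: one mult.commute mult.left_commute sum_distrib_left[symmetric])
    also have "\<dots> = (\<integral>\<omega>\<in>G. Y s \<omega> \<partial>M)" by (rule martingaleD(3)[OF Y G st])
    finally show ?thesis .
  qed
  show ?C if c: "0 \<le> c"
  proof -
    have ex: "integrable M (\<lambda>\<omega>. excess c (Y v \<omega>))" if "0 \<le> v" for v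
      by (rule integrable_excess[OF martingaleD(2)[OF Y that] c])
    have "(\<integral>\<omega>. excess c (Y (next_point s t m (R \<omega>)) \<omega>) \<partial>M)
        = (\<integral>\<omega>. (\<Sum>k\<le>m. indicator (E k) \<omega> * excess c (Y (u k) \<omega>)) \<partial>M)"
      by (intro Bochner_Integration.integral_cong) (auto simp: np)
    also have "\<dots> = (\<Sum>k\<le>m. \<integral>\<omega>. indicator (E k) \<omega> * excess c (Y (u k) \<omega>) \<partial>M)"
      using u by (subst Bochner_Integration.integral_sum) (auto intro!: intE ex)
    also have "\<dots> \<le> (\<Sum>k\<le>m. \<integral>\<omega>. indicator (E k) \<omega> * excess c (Y t \<omega>) \<partial>M)"
      using martingale_excess_mono[OF Y u(1) u(3) E c] 
      by (intro sum_mono) (simp add: set_lebesgue_integral_def)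
    also have "\<dots> = (\<integral>\<omega>. (\<Sum>k\<le>m. indicator (E k) \<omega> * excess c (Y t \<omega>)) \<partial>M)"
      using st by (subst Bochner_Integration.integral_sum) (auto intro!: intE ex)
    also have "\<dots> = (\<integral>\<omega>. excess c (Y t \<omega>) \<partial>M)"
      by (intro Bochner_Integration.integral_cong) (auto simp: one sum_distrib_right[symmetric])
    finally show ?thesis .
  qed
qed

definition AE_right_continuous :: "(real \<Rightarrow> 'a \<Rightarrow> real) \<Rightarrow> bool" where
  "AE_right_continuous Y \<longleftrightarrow> (AE \<omega> in M. \<forall>u\<ge>0. ((\<lambda>t. Y t \<omega>) \<longlongrightarrow> Y u \<omega>) (at_right u))"

text \<open>Right-continuity gives convergence of the discretized values, and the excess bound by
  \<open>Y t\<close> lets their integrals converge. The limit is represented by a measurable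
  \<open>Z\<close>, because the value at an optional time of a process with almost surely regular
  paths need not be measurable.\<close>

lemma martingale_optional_sampling:
  assumes Y: "martingale M F Y" "AE_right_continuous Y"
    and st: "0 \<le> s" "s \<le> t" and R: "optional_upto t R"
    and Z: "Z \<in> borel_measurable M" "AE \<omega> in M. Z \<omega> = Y (max s (min (R \<omega>) t)) \<omega>"
  shows "integrable M Z" and "G \<in> sets (F s) \<Longrightarrow> (\<integral>\<omega>\<in>G. Z \<omega> \<partial>M) = (\<integral>\<omega>\<in>G. Y s \<omega> \<partial>M)"
proof -
  define f where "f m \<omega> = Y (next_point s t (Suc m) (R \<omega>)) \<omega>" for m \<omega>
  note np = martingale_next_point[OF Y(1) st R zero_less_Suc]
  have Yt: "integrable M (Y t)" using martingaleD(2)[OF Y(1)] st by auto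
  have lim: "AE \<omega> in M. (\<lambda>m. f m \<omega>) \<longlonglongrightarrow> Z \<omega>"
    using Y(2)[unfolded AE_right_continuous_def] Z(2)
  proof eventually_elim
    case (elim \<omega>)
    show ?case unfolding f_def elim(2)
      by (rule next_point_tendsto[where y="\<lambda>u. Y u \<omega>"]) (use st elim in auto)
  qed
  have f: "integrable M (f m)" for m unfolding f_def by (rule np(1))
  have c: "(\<integral>\<omega>. excess k (f m \<omega>) \<partial>M) \<le> (\<integral>\<omega>. excess k (Y t \<omega>) \<partial>M)" if "0 \<le> k" for m k
    unfolding f_def by (rule np(3)[OF that])
  show "integrable M Z" by (rule set_integral_tendsto_of_excess_le(1)[OF f Z(1) lim Yt c])
  show "(\<integral>\<omega>\<in>G. Z \<omega> \<partial>M) = (\<integral>\<omega>\<in>G. Y s \<omega> \<partial>M)" if G: "G \<in> sets (F s)"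
  proof -
    have "(\<lambda>m. \<integral>\<omega>\<in>G. f m \<omega> \<partial>M) \<longlonglongrightarrow> (\<integral>\<omega>\<in>G. Z \<omega> \<partial>M)"
      using set_integral_tendsto_of_excess_le(2)[OF f Z(1) lim Yt c sets_F_subset[OF G]] by simp
    moreover have "(\<integral>\<omega>\<in>G. f m \<omega> \<partial>M) = (\<integral>\<omega>\<in>G. Y s \<omega> \<partial>M)" for m
      unfolding f_def by (rule np(2)[OF G])
    ultimately show ?thesis by (simp add: LIMSEQ_const_iff)
  qed
qed

text \<open>The optional time may depend on the horizon \<open>t\<close>, since the level times to
  which this is applied are cut off at a horizon.\<close>

lemma martingale_optional_stopping:
  assumes Y: "martingale M F Y" "AE_right_continuous Y" and Z: "adapted F Z"
    and R: "\<And>t. 0 \<le> t \<Longrightarrow> \<exists>R. (\<forall>\<omega>\<in>space M. 0 \<le> R \<omega>) \<and> optional_upto t R \<and>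
       (AE \<omega> in M. \<forall>s. 0 \<le> s \<longrightarrow> s \<le> t \<longrightarrow> Z s \<omega> = Y (min (R \<omega>) s) \<omega>)"
  shows "martingale M F Z"
  unfolding martingale_iff
proof (intro conjI allI ballI impI Z)
  have Zm: "Z t \<in> borel_measurable M" if "0 \<le> t" for t
    using Z that by (auto simp: adapted_def intro: measurable_F)
  have int: "integrable M (Z t)" if t: "0 \<le> t" for t
  proof -
    obtain R where R': "\<forall>\<omega>\<in>space M. 0 \<le> R \<omega>" "optional_upto t R"
       "AE \<omega> in M. \<forall>s. 0 \<le> s \<longrightarrow> s \<le> t \<longrightarrow> Z s \<omega> = Y (min (R \<omega>) s) \<omega>"
      using R[OF t] by auto
    have "AE \<omega> in M. Z t \<omega> = Y (max 0 (min (R \<omega>) t)) \<omega>"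
      using R'(3) AE_space
    proof eventually_elim
      case (elim \<omega>)
      then have "max 0 (min (R \<omega>) t) = min (R \<omega>) t" using R'(1) t by auto
      then show ?case using elim t by simp
    qed
    from martingale_optional_sampling(1)[OF Y _ t R'(2) Zm[OF t] this]
    show ?thesis by simp
  qed
  then show "integrable M (Z t)" if t: "0 \<le> t" for t using t by simp
  fix s t G assume G: "G \<in> sets (F s)" and st: "0 \<le> s" "s \<le> (t::real)"
  then have t: "0 \<le> t" by simp
  have GM[measurable]: "G \<in> events" using G by (rule sets_F_subset)
  obtain R where R': "\<forall>\<omega>\<in>space M. 0 \<le> R \<omega>" "optional_upto t R"
     "AE \<omega> in M. \<forall>s. 0 \<le> s \<longrightarrow> s \<le> t \<longrightarrow> Z s \<omega> = Y (min (R \<omega>) s) \<omega>"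
    using R[OF t] by auto
  have Ys: "integrable M (Y s)" using martingaleD(2)[OF Y(1) st(1)] .
  \<comment> \<open>If \<open>R\<close> is at most \<open>s\<close>, then \<open>Z t = Z s\<close>
    and \<open>W = Y s\<close>; otherwise \<open>Z s = Y s\<close> and \<open>W = Z t\<close>. In
    both cases \<open>W\<close> is the value of \<open>Y\<close> at \<open>max s (min R t)\<close>,
    so sampling shows that \<open>W\<close> and \<open>Y s\<close> have the same integral over
    \<open>G\<close>, and \<open>Z t\<close> and \<open>Z s\<close> then do too.\<close>
  define W where "W \<omega> = Z t \<omega> - Z s \<omega> + Y s \<omega>" for \<omega>
  have Wm: "W \<in> borel_measurable M"
    unfolding W_def using Zm[OF t] Zm[OF st(1)] Ys by auto
  have "AE \<omega> in M. W \<omega> = Y (max s (min (R \<omega>) t)) \<omega>"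
    using R'(3)
  proof eventually_elim
    case (elim \<omega>)
    have "Z t \<omega> = Y (min (R \<omega>) t) \<omega>" "Z s \<omega> = Y (min (R \<omega>) s) \<omega>" using elim st by auto
    then show ?case using st unfolding W_def by (cases "R \<omega> \<le> s") (auto simp: min_def max_def)
  qed
  note W = martingale_optional_sampling[OF Y st R'(2) Wm this]
  have si: "set_integrable M G f" if "integrable M f" for f :: "'a \<Rightarrow> real"
    using integrable_mult_indicator[OF GM that] by (simp add: set_integrable_def)
  have "(\<integral>\<omega>\<in>G. W \<omega> \<partial>M) = (\<integral>\<omega>\<in>G. Z t \<omega> \<partial>M) - (\<integral>\<omega>\<in>G. Z s \<omega> \<partial>M) + (\<integral>\<omega>\<in>G. Y s \<omega> \<partial>M)"
    unfolding W_def using si[OF int[OF t]] si[OF int[OF st(1)]] si[OF Ys]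
    by (simp add: set_integral_add set_integral_diff)
  with W(2)[OF G] show "(\<integral>\<omega>\<in>G. Z t \<omega> \<partial>M) = (\<integral>\<omega>\<in>G. Z s \<omega> \<partial>M)" by simp
qed

end

section \<open>Level times and stopped processes\<close>

text \<open>For continuous increasing \<open>y\<close> this is the right-continuous inverse of
  \<open>y\<close> at \<open>c\<close>, cut off at \<open>t\<close> to be finite;
  \<open>insert 0\<close> supplies a value when the level is exceeded from the start.\<close>

definition level_time :: "(real \<Rightarrow> real) \<Rightarrow> real \<Rightarrow> real \<Rightarrow> real" where
  "level_time y c t = Sup (insert 0 {u \<in> {0..t}. y u \<le> c})"

text \<open>For continuous increasing \<open>y\<close> this is the first time at which
  \<open>c\<close> is reached, capped at \<open>t\<close>. Along an adapted process it is a stopping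
  time of the raw filtration, whereas \<open>level_time\<close> is in general only optional; this
  one therefore serves for localization.\<close>

definition strict_level_time :: "(real \<Rightarrow> real) \<Rightarrow> real \<Rightarrow> real \<Rightarrow> real" where
  "strict_level_time y c t = Sup (insert 0 {u \<in> {0..t}. y u < c})"

lemma level_time_bounds:
  assumes "0 \<le> t" shows "0 \<le> level_time y c t" "level_time y c t \<le> t"
proof -
  have "bdd_above (insert 0 {u \<in> {0..t}. y u \<le> c})" by (auto intro!: bdd_aboveI[of _ t])
  then show "0 \<le> level_time y c t" unfolding level_time_def by (intro cSup_upper) auto
  show "level_time y c t \<le> t" unfolding level_time_def using assms by (intro cSup_least) auto
qed

lemma strict_level_time_bounds:
  assumes "0 \<le> t" shows "0 \<le> strict_level_time y c t" "strict_level_time y c t \<le> t"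
proof -
  have "bdd_above (insert 0 {u \<in> {0..t}. y u < c})" by (auto intro!: bdd_aboveI[of _ t])
  then show "0 \<le> strict_level_time y c t" unfolding strict_level_time_def by (intro cSup_upper) auto
  show "strict_level_time y c t \<le> t" unfolding strict_level_time_def using assms by (intro cSup_least) auto
qed

lemma continuous_on_Ici_limits:
  fixes y :: "real \<Rightarrow> real"
  assumes y: "continuous_on {0..} y" and t: "0 \<le> t"
  shows "(y \<longlongrightarrow> y t) (at_right t)" "0 < t \<Longrightarrow> (y \<longlongrightarrow> y t) (at_left t)"
proof -
  have *: "(y \<longlongrightarrow> y t) (at t within {0..})" using y t by (simp add: continuous_on_def)
  show "(y \<longlongrightarrow> y t) (at_right t)" by (rule tendsto_within_subset[OF *]) (use t in auto)
  assume t': "0 < t"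
  then have "at t within {0..} = at t" by (intro at_within_interior) auto
  with * show "(y \<longlongrightarrow> y t) (at_left t)" by (simp add: filterlim_at_split)
qed

context
  fixes y :: "real \<Rightarrow> real"
  assumes cont: "continuous_on {0..} y" and mono: "mono_on {0..} y"
begin

lemma path_mono: "0 \<le> u \<Longrightarrow> u \<le> v \<Longrightarrow> y u \<le> y v"
  using mono by (auto simp: mono_on_def)

lemma path_less_right:
  assumes "0 \<le> u" "y u < c" "u < t"
  obtains v where "u < v" "v < t" "y v < c"
proof -
  have "\<forall>\<^sub>F v in at_right u. y v < c"
    by (rule order_tendstoD(2)[OF continuous_on_Ici_limits(1)[OF cont assms(1)] assms(2)])
  then have "\<forall>\<^sub>F v in at_right u. y v < c \<and> v \<in> {u<..<t}"
    using eventually_at_right_real[OF assms(3)] by eventually_elim auto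
  from eventually_happens[OF this] show ?thesis using that by (auto simp: trivial_limit_at_right_real)
qed

lemma path_greater_left:
  assumes "0 < u" "c < y u"
  obtains v where "0 < v" "v < u" "c < y v"
proof -
  have "\<forall>\<^sub>F v in at_left u. c < y v"
    using order_tendstoD(1)[OF continuous_on_Ici_limits(2)[OF cont _ assms(1)] assms(2)] assms(1) by simp
  then have "\<forall>\<^sub>F v in at_left u. c < y v \<and> v \<in> {0<..<u}"
    using eventually_at_left_real[OF assms(1)] by eventually_elim auto
  from eventually_happens[OF this] show ?thesis using that by (auto simp: trivial_limit_at_left_real)
qed

lemma level_time_upper:
  assumes "0 \<le> u" "u \<le> t" "y u \<le> c"
  shows "u \<le> level_time y c t"
  unfolding level_time_def using assms
  by (intro cSup_upper bdd_aboveI[of _ "max 0 t"]) auto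

lemma strict_level_time_upper:
  assumes "0 \<le> u" "u \<le> t" "y u < c"
  shows "u \<le> strict_level_time y c t"
  unfolding strict_level_time_def using assms
  by (intro cSup_upper bdd_aboveI[of _ "max 0 t"]) auto

text \<open>If \<open>y\<close> exceeds \<open>c\<close> at \<open>u\<close>, then by
  left-continuity it does so slightly earlier, which makes the inequality on the left strict. For
  adapted paths the right side is an event of \<open>F u\<close>, so level times are
  optional.\<close>

lemma level_time_less_iff:
  assumes u: "0 < u" "u \<le> t"
  shows "level_time y c t < u \<longleftrightarrow> c < y u"
proof
  show "c < y u" if "level_time y c t < u"
    using level_time_upper[of u t c] u that by (cases "y u \<le> c") auto
  assume "c < y u"
  then obtain v where v: "0 < v" "v < u" "c < y v" using path_greater_left[OF u(1)] by auto
  have "level_time y c t \<le> v"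
    unfolding level_time_def
  proof (rule cSup_least)
    fix x assume "x \<in> insert 0 {u \<in> {0..t}. y u \<le> c}"
    then show "x \<le> v" using v path_mono[of v x] by (cases "x \<le> v") auto
  qed simp
  then show "level_time y c t < u" using v by simp
qed

text \<open>A level that is later exceeded is attained exactly at the level time and exceeded
  immediately afterwards. The level time is thus a point of increase from the right, which ties it
  to the zeros of \<open>X\<close>.\<close>

lemma level_time_eq:
  assumes 0: "y 0 \<le> c" and s: "0 \<le> s" "s \<le> t" "c < y s"
  shows "level_time y c t < s" "y (level_time y c t) = c" "\<And>v. level_time y c t < v \<Longrightarrow> c < y v"
proof -
  define r where "r = level_time y c t"
  have s0: "0 < s" using 0 s by (cases "s = 0") auto
  show r: "level_time y c t < s" using level_time_less_iff[OF s0 s(2)] s by simp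
  have r0: "0 \<le> r" using level_time_bounds[of t y c] s by (simp add: r_def)
  show gt: "c < y v" if v: "level_time y c t < v" for v
  proof (cases "v \<le> t")
    case True
    then show ?thesis using level_time_less_iff[of v t c] v r0 by (simp add: r_def)
  next
    case False
    then have "y s \<le> y v" using s by (intro path_mono) auto
    then show ?thesis using s by simp
  qed
  have "y r \<le> c"
  proof (rule ccontr)
    assume "\<not> y r \<le> c"
    then have c: "c < y r" by simp
    then have "0 < r" using r0 0 by (cases "r = 0") auto
    then show False using level_time_less_iff[of r t c] c r s by (simp add: r_def)
  qed
  moreover have "c \<le> y r"
  proof (rule ccontr)
    assume "\<not> c \<le> y r"
    then obtain v where "r < v" "y v < c" using path_less_right[of r c s] r r0 by (auto simp: r_def)
    then show False using gt[of v] by (simp add: r_def)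
  qed
  ultimately show "y (level_time y c t) = c" by (simp add: r_def)
qed

text \<open>Right-continuity takes the place of left-continuity here. At \<open>u = t\<close> the
  left side would hold for every level because of the cap, hence \<open>u < t\<close>.\<close>

lemma strict_level_time_le_iff:
  assumes u: "0 \<le> u" "u < t"
  shows "strict_level_time y c t \<le> u \<longleftrightarrow> c \<le> y u"
proof
  assume le: "strict_level_time y c t \<le> u"
  show "c \<le> y u"
  proof (rule ccontr)
    assume "\<not> c \<le> y u"
    then obtain v where "u < v" "v < t" "y v < c" using path_less_right[of u c t] u by auto
    then show False using strict_level_time_upper[of v t c] le u by auto
  qed
next
  assume c: "c \<le> y u"
  show "strict_level_time y c t \<le> u"
    unfolding strict_level_time_def
  proof (rule cSup_least)
    fix x assume "x \<in> insert 0 {u \<in> {0..t}. y u < c}"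
    then show "x \<le> u" using u c path_mono[of u x] by (cases "x \<le> u") auto
  qed simp
qed

text \<open>The hypothesis on \<open>y 0\<close> covers the default value \<open>0\<close> of the
  supremum.\<close>

lemma le_strict_level_time:
  assumes u: "0 \<le> u" "u \<le> strict_level_time y c t" and 0: "y 0 \<le> c" and t: "0 \<le> t"
  shows "y u \<le> c"
proof (rule ccontr)
  assume "\<not> y u \<le> c"
  then have c: "c < y u" by simp
  with 0 u have "0 < u" by (cases "u = 0") auto
  from path_greater_left[OF this c] obtain v where v: "0 < v" "v < u" "c < y v" .
  have "u \<le> t" using u strict_level_time_bounds(2)[OF t, of y c] by simp
  then have "strict_level_time y c t \<le> v" using strict_level_time_le_iff[of v t c] v by simp
  then show False using v u by simp
qed

end

section \<open>Stopped processes\<close>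

lemma cadlag_right: "cadlag y \<Longrightarrow> 0 \<le> u \<Longrightarrow> (y \<longlongrightarrow> y u) (at_right u)"
  by (simp add: cadlag_def)

lemma stopped_right_continuous:
  assumes "0 \<le> u" "((\<lambda>t. Y t \<omega>) \<longlongrightarrow> Y u \<omega>) (at_right u)"
  shows "((\<lambda>t. stopped T Y t \<omega>) \<longlongrightarrow> stopped T Y u \<omega>) (at_right u)"
proof (cases "u < T \<omega>")
  case True
  have "\<forall>\<^sub>F t in at_right u. stopped T Y t \<omega> = Y t \<omega>"
    by (rule eventually_mono[OF eventually_at_right_real[OF True]])
      (use assms(1) in \<open>auto simp: stopped_def\<close>)
  then show ?thesis
    using assms True by (subst tendsto_cong[where g="\<lambda>t. Y t \<omega>"]) (auto simp: stopped_def)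
next
  case False
  have "\<forall>\<^sub>F t in at_right u. stopped T Y t \<omega> = stopped T Y u \<omega>"
    by (rule eventually_mono[OF eventually_at_right_less[of u]])
      (use False in \<open>auto simp: stopped_def\<close>)
  then show ?thesis by (rule tendsto_eventually)
qed

context filtered_prob_space
begin

text \<open>Grid points up to \<open>t\<close> involve only \<open>F t\<close>, and the limit exists
  at every \<omega>. Without completeness, convergence off a null set would not give measurability
  with respect to \<open>F t\<close>.\<close>

lemma stopped_value_measurable:
  assumes Y: "adapted F Y" "\<And>\<omega> u. \<omega> \<in> space M \<Longrightarrow> 0 \<le> u \<Longrightarrow> ((\<lambda>t. Y t \<omega>) \<longlongrightarrow> Y u \<omega>) (at_right u)"
    and T: "stopping_time F T" "\<And>\<omega>. \<omega> \<in> space M \<Longrightarrow> 0 \<le> T \<omega>" and t: "0 \<le> t"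
  shows "(\<lambda>\<omega>. Y (min (T \<omega>) t) \<omega>) \<in> borel_measurable (F t)"
proof (rule borel_measurable_LIMSEQ_real)
  show "(\<lambda>\<omega>. Y (next_point 0 t (Suc m) (T \<omega>)) \<omega>) \<in> borel_measurable (F t)" for m
    by (rule next_point_measurable[OF Y(1) _ t optional_upto_stopping_time[OF T(1)]]) auto
  fix \<omega> assume "\<omega> \<in> space (F t)"
  then have \<omega>: "\<omega> \<in> space M" by (simp add: space_F)
  have "(\<lambda>m. Y (next_point 0 t (Suc m) (T \<omega>)) \<omega>) \<longlonglongrightarrow> Y (max 0 (min (T \<omega>) t)) \<omega>"
    by (rule next_point_tendsto[where y="\<lambda>u. Y u \<omega>"]) (use t Y(2)[OF \<omega>] in auto)
  then show "(\<lambda>m. Y (next_point 0 t (Suc m) (T \<omega>)) \<omega>) \<longlonglongrightarrow> Y (min (T \<omega>) t) \<omega>"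
    using T(2)[OF \<omega>] t by (simp add: max_absorb2)
qed

lemma stopped_adapted:
  assumes T: "stopping_time F T"
    and Y: "\<And>t. 0 \<le> t \<Longrightarrow> (\<lambda>\<omega>. Y (min (T \<omega>) t) \<omega>) \<in> borel_measurable (F t)"
  shows "adapted F (stopped T Y)"
  unfolding adapted_def
proof (intro allI impI)
  fix t :: real assume t: "0 \<le> t"
  have "Measurable.pred (F t) (\<lambda>\<omega>. \<not> T \<omega> \<le> 0)"
    using stopping_time_le_const[OF T t] by measurable
  then have "(\<lambda>\<omega>. if \<not> T \<omega> \<le> 0 then Y (min (T \<omega>) t) \<omega> else 0) \<in> borel_measurable (F t)"
    using Y[OF t] by (intro measurable_If) (auto simp: pred_def)
  then show "stopped T Y t \<in> borel_measurable (F t)"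
    by (simp add: stopped_def not_le)
qed

text \<open>The already stopped process is stopped once more at \<open>S\<close>. On
  \<open>{S = 0}\<close> optional stopping returns the initial value while \<open>stopped\<close>
  returns \<open>0\<close>; the two agree because \<open>Y\<close> is null at 0.\<close>

lemma martingale_stopped_min:
  assumes Y: "martingale M F (stopped T Y)" "AE_right_continuous Y" "AE \<omega> in M. Y 0 \<omega> = 0"
    and T: "\<And>\<omega>. \<omega> \<in> space M \<Longrightarrow> 0 \<le> T \<omega>"
    and S: "stopping_time F S" "\<And>\<omega>. \<omega> \<in> space M \<Longrightarrow> 0 \<le> S \<omega>"
    and Z: "adapted F (stopped (\<lambda>\<omega>. min (T \<omega>) (S \<omega>)) Y)"
  shows "martingale M F (stopped (\<lambda>\<omega>. min (T \<omega>) (S \<omega>)) Y)"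
proof (rule martingale_optional_stopping[OF Y(1) _ Z])
  show "AE_right_continuous (stopped T Y)"
    using Y(2) unfolding AE_right_continuous_def
    by eventually_elim (auto intro: stopped_right_continuous)
  fix t :: real assume "0 \<le> t"
  have "AE \<omega> in M. \<forall>s. 0 \<le> s \<longrightarrow> s \<le> t \<longrightarrow>
      stopped (\<lambda>\<omega>. min (T \<omega>) (S \<omega>)) Y s \<omega> = stopped T Y (min (S \<omega>) s) \<omega>"
    using Y(3) AE_space
  proof eventually_elim
    case (elim \<omega>)
    then have "0 \<le> T \<omega>" "0 \<le> S \<omega>" using T S by auto
    with elim show ?case by (cases "S \<omega> = 0") (auto simp: stopped_def min.assoc min.absorb1 min.absorb2)
  qed
  then show "\<exists>R. (\<forall>\<omega>\<in>space M. 0 \<le> R \<omega>) \<and> optional_upto t R \<and> (AE \<omega> in M. \<forall>s. 0 \<le> s \<longrightarrow> s \<le> t \<longrightarrow>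
      stopped (\<lambda>\<omega>. min (T \<omega>) (S \<omega>)) Y s \<omega> = stopped T Y (min (R \<omega>) s) \<omega>)"
    using S optional_upto_stopping_time[OF S(1)] by blast
qed

text \<open>This is the generating case of the monotone class argument, with \<open>L + a\<close> in
  the role of \<open>X\<close>. While \<open>a\<close> is at most \<open>c\<close> the expression is
  \<open>L\<close>; afterwards it is the constant \<open>- c\<close>, the value of \<open>L\<close>
  at the level time, because \<open>L + a\<close> vanishes at points of increase. The closed formula
  also shows that the stopped process is adapted although the level time is only optional.\<close>

lemma martingale_level:
  assumes L: "martingale M F L" "AE_right_continuous L"
    and a: "adapted F a" "\<And>\<omega>. \<omega> \<in> space M \<Longrightarrow> continuous_on {0..} (\<lambda>t. a t \<omega>)"
      "\<And>\<omega>. \<omega> \<in> space M \<Longrightarrow> mono_on {0..} (\<lambda>t. a t \<omega>)"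
    and a0: "AE \<omega> in M. a 0 \<omega> = 0"
    and zero: "AE \<omega> in M. \<forall>u\<ge>0. (\<forall>v>u. a u \<omega> < a v \<omega>) \<longrightarrow> L u \<omega> + a u \<omega> = 0"
    and c: "0 \<le> c"
  shows "martingale M F (\<lambda>t \<omega>. (if a t \<omega> \<le> c then L t \<omega> + a t \<omega> else 0) - min (a t \<omega>) c)"
proof (rule martingale_optional_stopping[OF L])
  show "adapted F (\<lambda>t \<omega>. (if a t \<omega> \<le> c then L t \<omega> + a t \<omega> else 0) - min (a t \<omega>) c)"
    unfolding adapted_def
  proof (intro allI impI)
    fix t :: real assume t: "0 \<le> t"
    have [measurable]: "a t \<in> borel_measurable (F t)" "L t \<in> borel_measurable (F t)"
      using adaptedD[OF a(1) t] adaptedD[OF martingaleD(1)[OF L(1)] t] by auto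
    show "(\<lambda>\<omega>. (if a t \<omega> \<le> c then L t \<omega> + a t \<omega> else 0) - min (a t \<omega>) c) \<in> borel_measurable (F t)"
      by measurable
  qed
  fix t :: real assume t: "0 \<le> t"
  define R where "R \<omega> = level_time (\<lambda>t. a t \<omega>) c t" for \<omega>
  have "optional_upto t R"
    unfolding optional_upto_def
  proof (intro allI impI)
    fix u assume u: "0 \<le> u" "u \<le> t"
    show "{\<omega>\<in>space M. R \<omega> < u} \<in> sets (F u)"
    proof (cases "u = 0")
      case True
      then have "{\<omega>\<in>space M. R \<omega> < u} = {}"
        using level_time_bounds(1)[OF t] by (auto simp: R_def not_less)
      then show ?thesis by (simp only: sets.empty_sets)
    next
      case False
      then have "{\<omega>\<in>space M. R \<omega> < u} = {\<omega>\<in>space (F u). c < a u \<omega>}"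
        using u level_time_less_iff[OF a(2) a(3)] by (auto simp: R_def space_F)
      also have "\<dots> \<in> sets (F u)"
        using adaptedD[OF a(1) u(1)] by measurable
      finally show ?thesis .
    qed
  qed
  moreover have "\<forall>\<omega>\<in>space M. 0 \<le> R \<omega>" using level_time_bounds(1)[OF t] by (simp add: R_def)
  moreover have "AE \<omega> in M. \<forall>s. 0 \<le> s \<longrightarrow> s \<le> t \<longrightarrow>
      (if a s \<omega> \<le> c then L s \<omega> + a s \<omega> else 0) - min (a s \<omega>) c = L (min (R \<omega>) s) \<omega>"
    using a0 zero AE_space
  proof (eventually_elim, intro allI impI)
    fix \<omega> s assume \<omega>: "a 0 \<omega> = 0" "\<forall>u\<ge>0. (\<forall>v>u. a u \<omega> < a v \<omega>) \<longrightarrow> L u \<omega> + a u \<omega> = 0" "\<omega> \<in> space M"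
      and s: "0 \<le> s" "s \<le> t"
    note a' = a(2)[OF \<omega>(3)] a(3)[OF \<omega>(3)]
    show "(if a s \<omega> \<le> c then L s \<omega> + a s \<omega> else 0) - min (a s \<omega>) c = L (min (R \<omega>) s) \<omega>"
    proof (cases "a s \<omega> \<le> c")
      case True
      then have "s \<le> R \<omega>" using level_time_upper[OF a' s] by (simp add: R_def)
      then show ?thesis using True by (simp add: min_absorb2)
    next
      case False
      then have "c < a s \<omega>" by simp
      from level_time_eq[OF a' _ s this] \<omega>(1) c
      have R: "R \<omega> < s" "a (R \<omega>) \<omega> = c" "\<And>v. R \<omega> < v \<Longrightarrow> c < a v \<omega>"
        by (simp_all add: R_def)
      have "0 \<le> R \<omega>" using level_time_bounds(1)[OF t] by (simp add: R_def)
      with \<omega>(2) R have "L (R \<omega>) \<omega> + c = 0" by metis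
      then show ?thesis using R False by simp
    qed
  qed
  ultimately show "\<exists>R. (\<forall>\<omega>\<in>space M. 0 \<le> R \<omega>) \<and> optional_upto t R \<and> (AE \<omega> in M. \<forall>s. 0 \<le> s \<longrightarrow> s \<le> t \<longrightarrow>
      (if a s \<omega> \<le> c then L s \<omega> + a s \<omega> else 0) - min (a s \<omega>) c = L (min (R \<omega>) s) \<omega>)"
    by blast
qed

end

section \<open>Transforms by bounded Borel functions\<close>

lemma measurable_Icc_integral:
  fixes f :: "real \<Rightarrow> real"
  assumes [measurable]: "f \<in> borel_measurable borel" "g \<in> borel_measurable N" "h \<in> borel_measurable N"
  shows "(\<lambda>x. LBINT z:{g x..h x}. f z) \<in> borel_measurable N"
proof -
  have "(\<lambda>x. \<integral>z. (if g x \<le> z \<and> z \<le> h x then f z else 0) \<partial>lborel) \<in> borel_measurable N"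
    by (rule lborel.borel_measurable_lebesgue_integral) measurable
  moreover have "(LBINT z:{g x..h x}. f z) = (\<integral>z. (if g x \<le> z \<and> z \<le> h x then f z else 0) \<partial>lborel)" for x
    unfolding set_lebesgue_integral_def by (rule Bochner_Integration.integral_cong) auto
  ultimately show ?thesis by simp
qed

lemma integrable_indicator_Icc_mult: "integrable lborel (\<lambda>z::real. indicator {a..b} z * (k::real))"
  by (intro integrable_mult_left integrable_real_indicator) (auto simp: emeasure_lborel_Icc_eq)

lemma set_integrable_Icc_bounded:
  fixes f :: "real \<Rightarrow> real"
  assumes "f \<in> borel_measurable borel" "\<And>z. z \<in> {a..b} \<Longrightarrow> \<bar>f z\<bar> \<le> k"
  shows "set_integrable lborel {a..b} f"
  unfolding set_integrable_def
proof (rule Bochner_Integration.integrable_bound)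
  show "integrable lborel (\<lambda>z. indicator {a..b} z * k)" by (rule integrable_indicator_Icc_mult)
  show "AE z in lborel. norm (indicator {a..b} z *\<^sub>R f z) \<le> norm (indicator {a..b} z * k)"
    using assms(2) by (intro AE_I2) (force simp: indicator_def)
qed (use assms(1) in measurable)

lemma abs_Icc_integral_le:
  fixes f :: "real \<Rightarrow> real"
  assumes f: "f \<in> borel_measurable borel" "\<And>z. z \<in> {a..b} \<Longrightarrow> \<bar>f z\<bar> \<le> k" and "a \<le> b"
  shows "\<bar>LBINT z:{a..b}. f z\<bar> \<le> k * (b - a)"
proof -
  have "\<bar>LBINT z:{a..b}. f z\<bar> \<le> (\<integral>z. \<bar>indicator {a..b} z * f z\<bar> \<partial>lborel)"
    unfolding set_lebesgue_integral_def by simp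
  also have "\<dots> \<le> (\<integral>z. indicator {a..b} z * k \<partial>lborel)"
  proof (rule integral_mono)
    show "integrable lborel (\<lambda>z. \<bar>indicator {a..b} z * f z\<bar>)"
      using set_integrable_Icc_bounded[OF f] by (simp add: set_integrable_def)
    show "\<bar>indicator {a..b} z * f z\<bar> \<le> indicator {a..b} z * k" for z
      using f(2) by (auto simp: indicator_def)
  qed (rule integrable_indicator_Icc_mult)
  also have "\<dots> = k * (b - a)" using \<open>a \<le> b\<close> by simp
  finally show ?thesis .
qed

text \<open>The set integral avoids the sign cases of the interval integral. Both agree for
  nonnegative \<open>a t \<omega>\<close>, which holds almost surely where this is used.\<close>

definition transform :: "(real \<Rightarrow> real) \<Rightarrow> (real \<Rightarrow> 'a \<Rightarrow> real) \<Rightarrow> (real \<Rightarrow> 'a \<Rightarrow> real) \<Rightarrow> real \<Rightarrow> 'a \<Rightarrow> real" where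
  "transform f x a t \<omega> = (LBINT z:{0..a t \<omega>}. f z) - f (a t \<omega>) * x t \<omega>"

lemma transform_add:
  assumes "f \<in> borel_measurable borel" "\<And>z. \<bar>f z\<bar> \<le> k" "g \<in> borel_measurable borel" "\<And>z. \<bar>g z\<bar> \<le> l"
  shows "transform (\<lambda>z. f z + g z) x a t \<omega> = transform f x a t \<omega> + transform g x a t \<omega>"
proof -
  have "set_integrable lborel {0..a t \<omega>} f" "set_integrable lborel {0..a t \<omega>} g"
    using assms by (auto intro: set_integrable_Icc_bounded)
  then show ?thesis by (simp add: transform_def algebra_simps)
qed

lemma transform_cmult: "transform (\<lambda>z. c * f z) x a t \<omega> = c * transform f x a t \<omega>"
  by (simp add: transform_def algebra_simps)

lemma transform_tendsto:
  assumes f: "\<And>i. f i \<in> borel_measurable borel" "\<And>i z. \<bar>f i z\<bar> \<le> k"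
    and g: "g \<in> borel_measurable borel" and lim: "\<And>z. (\<lambda>i. f i z) \<longlonglongrightarrow> g z"
  shows "(\<lambda>i. transform (f i) x a t \<omega>) \<longlonglongrightarrow> transform g x a t \<omega>"
proof -
  have "(\<lambda>i. LBINT z:{0..a t \<omega>}. f i z) \<longlonglongrightarrow> (LBINT z:{0..a t \<omega>}. g z)"
    unfolding set_lebesgue_integral_def
  proof (rule integral_dominated_convergence[where w="\<lambda>z. indicator {0..a t \<omega>} z * k"])
    show "AE z in lborel. (\<lambda>i. indicator {0..a t \<omega>} z *\<^sub>R f i z) \<longlonglongrightarrow> indicator {0..a t \<omega>} z *\<^sub>R g z"
      using lim by (intro AE_I2 tendsto_intros)
    show "AE z in lborel. norm (indicator {0..a t \<omega>} z *\<^sub>R f i z) \<le> indicator {0..a t \<omega>} z * k" for i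
      using f(2) by (intro AE_I2) (auto simp: indicator_def)
  qed (use f g integrable_indicator_Icc_mult in auto)
  then show ?thesis unfolding transform_def using lim by (intro tendsto_intros)
qed

context filtered_prob_space
begin

lemma transform_adapted:
  assumes "f \<in> borel_measurable borel" "adapted F x" "adapted F a"
  shows "adapted F (transform f x a)"
  unfolding adapted_def transform_def
proof (intro allI impI)
  fix t :: real assume t: "0 \<le> t"
  have [measurable]: "f \<in> borel_measurable borel" "x t \<in> borel_measurable (F t)" "a t \<in> borel_measurable (F t)"
    using assms t by (auto simp: adapted_def)
  show "(\<lambda>\<omega>. (LBINT z:{0..a t \<omega>}. f z) - f (a t \<omega>) * x t \<omega>) \<in> borel_measurable (F t)"
    by (intro borel_measurable_diff measurable_Icc_integral) measurable
qed

section \<open>Monotone class argument for a martingale \<open>L\<close> and a bounded increasing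
  process \<open>a\<close>\<close>

context
  fixes L a :: "real \<Rightarrow> 'a \<Rightarrow> real" and n :: real
  assumes L: "martingale M F L" "AE_right_continuous L"
    and a: "adapted F a" "\<And>\<omega>. \<omega> \<in> space M \<Longrightarrow> continuous_on {0..} (\<lambda>t. a t \<omega>)"
      "\<And>\<omega>. \<omega> \<in> space M \<Longrightarrow> mono_on {0..} (\<lambda>t. a t \<omega>)"
    and a0: "AE \<omega> in M. a 0 \<omega> = 0"
    and an: "AE \<omega> in M. \<forall>t\<ge>0. a t \<omega> \<le> n"
    and zero: "AE \<omega> in M. \<forall>u\<ge>0. (\<forall>v>u. a u \<omega> < a v \<omega>) \<longrightarrow> L u \<omega> + a u \<omega> = 0"
begin

definition transform_martingale :: "(real \<Rightarrow> real) \<Rightarrow> bool" where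
  "transform_martingale f \<longleftrightarrow> martingale M F (transform f (\<lambda>t \<omega>. L t \<omega> + a t \<omega>) a)"

lemma a_bounds: "AE \<omega> in M. \<forall>t\<ge>0. 0 \<le> a t \<omega> \<and> a t \<omega> \<le> n"
  using a0 an AE_space
proof eventually_elim
  case (elim \<omega>)
  then show ?case using path_mono[OF a(2) a(3), of \<omega> 0] by force
qed

lemma adapted_sum: "adapted F (\<lambda>t \<omega>. L t \<omega> + a t \<omega>)"
  using martingaleD(1)[OF L(1)] a(1) by (auto simp: adapted_def intro!: borel_measurable_add)

lemma transform_martingaleI:
  assumes "martingale M F Z" "f \<in> borel_measurable borel"
    and "\<And>t. 0 \<le> t \<Longrightarrow> AE \<omega> in M. transform f (\<lambda>t \<omega>. L t \<omega> + a t \<omega>) a t \<omega> = Z t \<omega>"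
  shows "transform_martingale f"
  unfolding transform_martingale_def
  by (rule martingale_cong_AE[OF assms(1) transform_adapted[OF assms(2) adapted_sum a(1)] assms(3)])

lemma transform_martingale_add:
  assumes "f \<in> borel_measurable borel" "\<And>z. \<bar>f z\<bar> \<le> k" "g \<in> borel_measurable borel" "\<And>z. \<bar>g z\<bar> \<le> l"
    and "transform_martingale f" "transform_martingale g"
  shows "transform_martingale (\<lambda>z. f z + g z)"
  using martingale_add[of "transform f _ a" "transform g _ a"] assms(5,6)
  unfolding transform_martingale_def
  by (subst transform_add[OF assms(1-4), abs_def]) simp

lemma transform_martingale_cmult:
  assumes "transform_martingale f"
  shows "transform_martingale (\<lambda>z. c * f z)"
  using martingale_cmult[of "transform f _ a"] assms
  unfolding transform_martingale_def
  by (subst transform_cmult[abs_def]) simp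

text \<open>The bound \<open>n\<close> on \<open>a\<close> enters here: it makes
  \<open>k * a + k * \<bar>L + a\<bar>\<close> integrable, and this dominates the transforms of all
  functions bounded by \<open>k\<close>.\<close>

lemma transform_martingale_tendsto:
  assumes f: "\<And>i. f i \<in> borel_measurable borel" "\<And>i z. \<bar>f i z\<bar> \<le> k" "\<And>i. transform_martingale (f i)"
    and g: "g \<in> borel_measurable borel" and lim: "\<And>z. (\<lambda>i. f i z) \<longlonglongrightarrow> g z"
  shows "transform_martingale g"
proof -
  let ?x = "\<lambda>t \<omega>. L t \<omega> + a t \<omega>"
  have am: "a t \<in> borel_measurable M" if "0 \<le> t" for t
    by (rule measurable_F[OF adaptedD[OF a(1) that]])
  have ai: "integrable M (a t)" if "0 \<le> t" for t
    by (rule integrable_const_bound[where B=n]) (use a_bounds am that in auto)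
  have gk: "\<bar>g z\<bar> \<le> k" for z
    by (rule LIMSEQ_le_const2[OF tendsto_rabs[OF lim]]) (use f(2) in auto)
  have k0: "0 \<le> k" using gk[of 0] by linarith
  have Tm: "transform h ?x a t \<in> borel_measurable M" if "h \<in> borel_measurable borel" "0 \<le> t" for h t
    by (rule measurable_F[OF adaptedD[OF transform_adapted[OF that(1) adapted_sum a(1)] that(2)]])
  have wi: "integrable M (\<lambda>\<omega>. k * a t \<omega> + k * \<bar>L t \<omega> + a t \<omega>\<bar>)" if "0 \<le> t" for t
    using ai[OF that] martingaleD(2)[OF L(1) that] by auto
  have bnd: "AE \<omega> in M. \<bar>transform h ?x a t \<omega>\<bar> \<le> k * a t \<omega> + k * \<bar>L t \<omega> + a t \<omega>\<bar>"
    if h: "h \<in> borel_measurable borel" "\<And>z. \<bar>h z\<bar> \<le> k" and t: "0 \<le> t" for h t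
    using a_bounds
  proof eventually_elim
    case (elim \<omega>)
    have "\<bar>LBINT z:{0..a t \<omega>}. h z\<bar> \<le> k * (a t \<omega> - 0)"
      using elim t by (intro abs_Icc_integral_le h) auto
    moreover have "\<bar>h (a t \<omega>) * (L t \<omega> + a t \<omega>)\<bar> \<le> k * \<bar>L t \<omega> + a t \<omega>\<bar>"
      using h(2) by (auto simp: abs_mult intro: mult_right_mono)
    ultimately show ?case unfolding transform_def by (smt (verit))
  qed
  have int: "integrable M (transform h ?x a t)"
    if h: "h \<in> borel_measurable borel" "\<And>z. \<bar>h z\<bar> \<le> k" and t: "0 \<le> t" for h t
    by (rule Bochner_Integration.integrable_bound[OF wi[OF t] Tm[OF h(1) t]])
      (use bnd[OF h t] in \<open>auto intro: order_trans elim!: eventually_mono\<close>)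
  have conv: "(\<lambda>i. \<integral>\<omega>\<in>G. transform (f i) ?x a t \<omega> \<partial>M) \<longlonglongrightarrow> (\<integral>\<omega>\<in>G. transform g ?x a t \<omega> \<partial>M)"
    if G[measurable]: "G \<in> events" and t: "0 \<le> t" for G t
    unfolding set_lebesgue_integral_def
  proof (rule integral_dominated_convergence[OF _ _ wi[OF t]])
    show "AE \<omega> in M. (\<lambda>i. indicator G \<omega> *\<^sub>R transform (f i) ?x a t \<omega>) \<longlonglongrightarrow> indicator G \<omega> *\<^sub>R transform g ?x a t \<omega>"
      by (intro AE_I2 tendsto_intros transform_tendsto[OF f(1,2) g lim])
    show "AE \<omega> in M. norm (indicator G \<omega> *\<^sub>R transform (f i) ?x a t \<omega>) \<le> k * a t \<omega> + k * \<bar>L t \<omega> + a t \<omega>\<bar>" for i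
      using bnd[OF f(1)[of i] f(2) t]
      by eventually_elim (auto simp: indicator_def)
  qed (use Tm[OF g t] Tm[OF f(1) t] in measurable)
  show ?thesis
    unfolding transform_martingale_def martingale_iff
  proof (intro conjI allI ballI impI)
    show "adapted F (transform g ?x a)" by (rule transform_adapted[OF g adapted_sum a(1)])
    show "integrable M (transform g ?x a t)" if "0 \<le> t" for t by (rule int[OF g gk that])
    fix s t G assume G: "G \<in> sets (F s)" and st: "0 \<le> s" "s \<le> (t::real)"
    have "(\<integral>\<omega>\<in>G. transform (f i) ?x a t \<omega> \<partial>M) = (\<integral>\<omega>\<in>G. transform (f i) ?x a s \<omega> \<partial>M)" for i
      using martingaleD(3)[OF f(3)[unfolded transform_martingale_def] G st] .
    with conv[OF sets_F_subset[OF G], of t] conv[OF sets_F_subset[OF G], of s] st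
    show "(\<integral>\<omega>\<in>G. transform g ?x a t \<omega> \<partial>M) = (\<integral>\<omega>\<in>G. transform g ?x a s \<omega> \<partial>M)"
      by (intro LIMSEQ_unique) auto
  qed
qed

lemma transform_martingale_atMost: "transform_martingale (indicator {..c})"
proof (cases "0 \<le> c")
  case True
  show ?thesis
  proof (rule transform_martingaleI[OF martingale_cmult[where c="-1", OF martingale_level[OF L a a0 zero True]]])
    fix t :: real assume t: "0 \<le> t"
    show "AE \<omega> in M. transform (indicator {..c}) (\<lambda>t \<omega>. L t \<omega> + a t \<omega>) a t \<omega>
        = - 1 * ((if a t \<omega> \<le> c then L t \<omega> + a t \<omega> else 0) - min (a t \<omega>) c)"
      using a_bounds
    proof eventually_elim
      case (elim \<omega>)
      have "(LBINT z:{0..a t \<omega>}. indicator {..c} z) = (\<integral>z. indicator {0..min (a t \<omega>) c} z \<partial>lborel)"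
        unfolding set_lebesgue_integral_def
        by (rule Bochner_Integration.integral_cong) (auto simp: indicator_def)
      also have "\<dots> = min (a t \<omega>) c" using elim t True by simp
      finally show ?case by (simp add: transform_def)
    qed
  qed measurable
next
  case False
  \<comment> \<open>A negative \<open>c\<close> lies below the range of \<open>a\<close>, so the
    transform is the zero martingale, written as \<open>0 * L\<close>.\<close>
  show ?thesis
  proof (rule transform_martingaleI[OF martingale_cmult[where c=0, OF L(1)]])
    fix t :: real assume t: "0 \<le> t"
    show "AE \<omega> in M. transform (indicator {..c}) (\<lambda>t \<omega>. L t \<omega> + a t \<omega>) a t \<omega> = 0 * L t \<omega>"
      using a_bounds
    proof eventually_elim
      case (elim \<omega>)
      have "(LBINT z:{0..a t \<omega>}. indicator {..c} z) = (\<integral>z. 0 \<partial>(lborel :: real measure))"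
        unfolding set_lebesgue_integral_def
        by (rule Bochner_Integration.integral_cong) (use False in \<open>auto simp: indicator_def\<close>)
      moreover have "\<not> a t \<omega> \<le> c" using elim t False by (meson order_trans)
      ultimately show ?case by (simp add: transform_def)
    qed
  qed measurable
qed

lemma transform_martingale_UNIV: "transform_martingale (indicator UNIV)"
proof (rule transform_martingaleI[OF martingale_cmult[where c="-1", OF L(1)]])
  fix t :: real assume t: "0 \<le> t"
  show "AE \<omega> in M. transform (indicator UNIV) (\<lambda>t \<omega>. L t \<omega> + a t \<omega>) a t \<omega> = - 1 * L t \<omega>"
    using a_bounds
  proof eventually_elim
    case (elim \<omega>)
    then show ?case using t by (simp add: transform_def set_lebesgue_integral_def)
  qed
qed simp

text \<open>Dynkin's argument: complements come from the constant function 1 by linearity, countable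
  disjoint unions from bounded limits of finite ones.\<close>

lemma transform_martingale_indicator:
  assumes "B \<in> sets borel"
  shows "transform_martingale (indicator B)"
proof -
  have "Int_stable (range (\<lambda>c::real. {..c}))"
    by (auto simp: Int_stable_def)
  moreover have "range (\<lambda>c::real. {..c}) \<subseteq> Pow UNIV" by simp
  moreover have "B \<in> sigma_sets UNIV (range (\<lambda>c::real. {..c}))"
    using assms unfolding borel_eq_atMost by (simp add: sets_measure_of)
  ultimately show ?thesis
  proof (induction rule: sigma_sets_induct_disjoint)
    case (compl A)
    have A[measurable]: "A \<in> sets borel"
      using compl(1) unfolding borel_eq_atMost by (simp add: sets_measure_of)
    have "transform_martingale (\<lambda>z. indicator UNIV z + (- 1) * indicator A z)"
      by (rule transform_martingale_add[where k=1 and l=1])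
        (use transform_martingale_UNIV transform_martingale_cmult[OF compl(2), of "-1"] in \<open>auto simp: indicator_def\<close>)
    moreover have "(\<lambda>z. indicator UNIV z + (- 1) * indicator A z) = (indicator (UNIV - A) :: real \<Rightarrow> real)"
      by (auto simp: indicator_def)
    ultimately show ?case by simp
  next
    case (union A)
    have A[measurable]: "A i \<in> sets borel" for i
      using union(2) unfolding borel_eq_atMost by (auto simp: sets_measure_of)
    have fin: "transform_martingale (indicator (\<Union>i<m. A i))" for m
    proof (induction m)
      case 0
      have "(\<lambda>z. 0 * indicator UNIV z) = (indicator {} :: real \<Rightarrow> real)" by auto
      then show ?case using transform_martingale_cmult[OF transform_martingale_UNIV, of 0] by simp
    next
      case (Suc m)
      have "disjnt (A m) (\<Union>i<m. A i)"
        using disjoint_family_onD[OF union(1), of m] by (fastforce simp: disjnt_def)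
      then have "indicator (\<Union>i<Suc m. A i) = (\<lambda>z. indicator (\<Union>i<m. A i) z + indicator (A m) z :: real)"
        by (auto simp: fun_eq_iff indicator_def lessThan_Suc disjnt_iff)
      moreover have "transform_martingale (\<lambda>z. indicator (\<Union>i<m. A i) z + indicator (A m) z)"
        by (rule transform_martingale_add[where k=1 and l=1]) (use Suc union(3) in \<open>auto simp: indicator_def\<close>)
      ultimately show ?case by simp
    qed
    show ?case
    proof (rule transform_martingale_tendsto[where k=1, OF _ _ fin])
      show "(\<lambda>m. indicator (\<Union>i<m. A i) z) \<longlonglongrightarrow> (indicator (\<Union>i. A i) z :: real)" for z
        by (rule LIMSEQ_indicator_UN)
    qed (auto simp: indicator_def)
  next
    case empty
    have "(\<lambda>z. 0 * indicator UNIV z) = (indicator {} :: real \<Rightarrow> real)" by auto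
    then show ?case using transform_martingale_cmult[OF transform_martingale_UNIV, of 0] by simp
  qed (auto simp: transform_martingale_atMost)
qed

text \<open>The limit step needs a uniform bound, so the bound has to travel through the induction;
  hence the implication, generalized over \<open>k\<close>. In a sum of nonnegative functions each
  term inherits the bound of the sum.\<close>

lemma transform_martingale_nonneg:
  assumes "f \<in> borel_measurable borel" "\<And>z. 0 \<le> f z" "\<And>z. f z \<le> k"
  shows "transform_martingale f"
proof -
  have "(\<forall>z. f z \<le> k) \<longrightarrow> transform_martingale f"
    using assms(1,2)
  proof (induction arbitrary: k rule: borel_measurable_induct_real)
    case (set A)
    then show ?case by (simp add: transform_martingale_indicator)
  next
    case (mult u c)
    show ?case
    proof
      assume *: "\<forall>z. c * u z \<le> k"
      show "transform_martingale (\<lambda>z. c * u z)"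
      proof (cases "c = 0")
        case True
        then show ?thesis using transform_martingale_cmult[OF transform_martingale_UNIV, of 0] by simp
      next
        case False
        then have "u z \<le> k / c" for z using *[rule_format, of z] mult.hyps(1) by (simp add: field_simps)
        then show ?thesis using mult.IH transform_martingale_cmult by blast
      qed
    qed
  next
    case (add u v)
    show ?case
    proof
      assume *: "\<forall>z. v z + u z \<le> k"
      have le: "u z \<le> k" "v z \<le> k" for z using *[rule_format, of z] add.hyps(2)[of z] add.hyps(4)[of z] by linarith+
      have uv: "transform_martingale u" "transform_martingale v" using add.IH le by blast+
      show "transform_martingale (\<lambda>z. v z + u z)"
        by (rule transform_martingale_add[where k=k and l=k]) (use uv add.hyps le in \<open>auto simp: abs_of_nonneg\<close>)
    qed
  next
    case (seq U k)
    show ?case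
    proof
      assume *: "\<forall>z. f z \<le> k"
      have le: "U i z \<le> k" for i z
        using incseq_le[of "\<lambda>i. U i z" "f z" i] seq.hyps(3,4) *[rule_format, of z]
        by (force simp: incseq_def le_fun_def)
      show "transform_martingale f"
      proof (rule transform_martingale_tendsto[where k=k and f=U])
        show "transform_martingale (U i)" for i using seq.IH le by blast
        show "f \<in> borel_measurable borel"
          using seq.hyps(1,4) by (intro borel_measurable_LIMSEQ_real[of borel U f]) auto
      qed (use seq.hyps le in \<open>auto simp: abs_of_nonneg\<close>)
    qed
  qed
  then show ?thesis using assms(3) by simp
qed

lemma transform_martingale_bounded:
  assumes f[measurable]: "f \<in> borel_measurable borel" and k: "\<And>z. \<bar>f z\<bar> \<le> k"
  shows "martingale M F (transform f (\<lambda>t \<omega>. L t \<omega> + a t \<omega>) a)"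
proof -
  have k': "f z \<le> k" "- f z \<le> k" "0 \<le> k" for z using k[of z] by auto
  have "transform_martingale (\<lambda>z. max 0 (f z) + (- 1) * max 0 (- f z))"
  proof (rule transform_martingale_add[where k=k and l=k])
    show "transform_martingale (\<lambda>z. max 0 (f z))"
      by (rule transform_martingale_nonneg[where k=k]) (use k' in auto)
    show "transform_martingale (\<lambda>z. (- 1) * max 0 (- f z))"
      by (intro transform_martingale_cmult transform_martingale_nonneg[where k=k]) (use k' in auto)
  qed (use k' in auto)
  moreover have "(\<lambda>z. max 0 (f z) + (- 1) * max 0 (- f z)) = f" by (auto simp: max_def)
  ultimately show ?thesis by (simp add: transform_martingale_def)
qed

end

end

section \<open>Paths carried by the zeros of another path\<close>

context
  fixes y :: "real \<Rightarrow> real"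
  assumes cont: "continuous_on {0..} y" and mono: "mono_on {0..} y"
begin

lemma continuous_on_max_0: "continuous_on UNIV (\<lambda>t. y (max 0 t))"
  by (rule continuous_on_compose2[OF cont]) (auto intro!: continuous_intros)

lemma mono_max_0: "u \<le> v \<Longrightarrow> y (max 0 u) \<le> y (max 0 v)"
  using mono by (auto simp: mono_on_def)

lemma emeasure_path_measure_Icc:
  assumes "0 \<le> u" "u \<le> v"
  shows "emeasure (path_measure y) {u..v} = ennreal (y v - y u)"
  unfolding path_measure_def using assms
  by (subst emeasure_interval_measure_Icc[OF _ mono_max_0 continuous_on_max_0])
    (auto simp: max_absorb2)

lemma sets_path_measure: "sets (path_measure y) = sets borel"
  by (simp add: path_measure_def)

lemma path_measure_carried_imp:
  assumes carried: "AE t in path_measure y. 0 \<le> t \<longrightarrow> x t = (0::real)"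
    and uv: "0 \<le> u" "u \<le> v" and nz: "\<And>t. u \<le> t \<Longrightarrow> t \<le> v \<Longrightarrow> x t \<noteq> 0"
  shows "y v = y u"
proof -
  have "AE t in path_measure y. t \<notin> {u..v}"
    using carried by eventually_elim (use nz uv in force)
  then have "emeasure (path_measure y) {u..v} = 0"
    by (subst (asm) AE_iff_measurable[of "{u..v}"])
      (auto simp: path_measure_def)
  then show ?thesis
    using emeasure_path_measure_Icc[OF uv] path_mono[OF cont mono uv] by simp
qed

text \<open>A time with a flat stretch of \<open>y\<close> to its right belongs to
  \<open>B q\<close> for some rational \<open>q\<close>, and every \<open>B q\<close> is null
  because \<open>y\<close> is constant on it. Hence almost every time is a point of increase from
  the right.\<close>

lemma path_measure_carriedI:
  assumes right: "\<And>t. 0 \<le> t \<Longrightarrow> x t \<noteq> (0::real) \<Longrightarrow> \<exists>v>t. y v = y t"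
  shows "AE t in path_measure y. 0 \<le> t \<longrightarrow> x t = 0"
proof -
  define B where "B q = {t. 0 \<le> t \<and> t \<le> q \<and> y t = y q}" for q :: real
  have null: "B q \<in> null_sets (path_measure y)" for q
  proof (cases "0 \<le> q")
    case True
    define p where "p = Inf (B q)"
    have qB: "q \<in> B q" using True by (simp add: B_def)
    have bdd: "bdd_below (B q)" by (rule bdd_belowI[of _ 0]) (simp add: B_def)
    \<comment> \<open>Closedness provides a least element \<open>p\<close>, so that
      \<open>B q\<close> lies in \<open>{p..q}\<close>, whose mass is
      \<open>y q - y p = 0\<close>.\<close>
    have "closed {t \<in> {0..q}. y t = y q}"
      by (intro continuous_closed_preimage_constant continuous_on_subset[OF cont]) auto
    moreover have "{t \<in> {0..q}. y t = y q} = B q" by (auto simp: B_def)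
    ultimately have "closed (B q)" by simp
    then have pB: "p \<in> B q" unfolding p_def using qB bdd by (intro closed_contains_Inf) auto
    have "B q \<subseteq> {p..q}" using cInf_lower[OF _ bdd] by (auto simp: p_def B_def)
    moreover have "{p..q} \<in> null_sets (path_measure y)"
      using emeasure_path_measure_Icc[of p q] pB
      by (intro null_setsI) (auto simp: B_def path_measure_def)
    moreover have "B q \<in> sets (path_measure y)"
      using \<open>closed (B q)\<close> by (simp add: sets_path_measure borel_closed)
    ultimately show ?thesis by (meson null_sets_subset)
  next
    case False
    then have "B q = {}" by (auto simp: B_def)
    then show ?thesis by simp
  qed
  have "(\<Union>q\<in>\<rat>. B q) \<in> null_sets (path_measure y)"
    by (rule null_sets_UN') (auto simp: null countable_rat)
  then have "AE t in path_measure y. t \<notin> (\<Union>q\<in>\<rat>. B q)" by (rule AE_not_in)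
  then show ?thesis
  proof (rule AE_mp, intro AE_I2 impI)
    fix t assume t: "t \<notin> (\<Union>q\<in>\<rat>. B q)" "0 \<le> t"
    show "x t = 0"
    proof (rule ccontr)
      assume "x t \<noteq> 0"
      then obtain v where v: "t < v" "y v = y t" using right t by auto
      obtain q where q: "q \<in> \<rat>" "t < q" "q < v" using Rats_dense_in_real[OF v(1)] by auto
      have "y t \<le> y q" "y q \<le> y v" using q t by (auto intro!: path_mono[OF cont mono])
      then have "t \<in> B q" using v q t by (simp add: B_def)
      then show False using t q by auto
    qed
  qed
qed

text \<open>This turns an almost everywhere statement into one about a single time: if
  \<open>x\<close> were nonzero at \<open>u\<close>, right-continuity would keep it nonzero on a
  short interval after \<open>u\<close>, and \<open>y\<close> would be flat there.\<close>

lemma carried_increase_imp_zero: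
  assumes carried: "AE t in path_measure y. 0 \<le> t \<longrightarrow> x t = (0::real)"
    and x: "cadlag x" and u: "0 \<le> u" "\<And>v. u < v \<Longrightarrow> y u < y v"
  shows "x u = 0"
proof (rule ccontr)
  assume nz: "x u \<noteq> 0"
  then have "\<forall>\<^sub>F t in at_right u. x t \<noteq> 0"
    by (rule tendsto_imp_eventually_ne[OF cadlag_right[OF x u(1)]])
  then obtain v where v: "u < v" "\<And>t. u < t \<Longrightarrow> t < v \<Longrightarrow> x t \<noteq> 0"
    by (auto simp: eventually_at_right_field)
  have "y ((u + v) / 2) = y u"
    by (rule path_measure_carried_imp[OF carried u(1)]) (use v nz in \<open>force simp: less_eq_real_def\<close>)+
  with u(2)[of "(u + v) / 2"] v(1) show False by simp
qed

text \<open>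
  Where \<open>x\<close> or its left limit does not vanish, \<open>y\<close> is locally constant, so the irregularity
  of \<open>f\<close> is invisible; elsewhere it is multiplied by \<open>0\<close>.
\<close>

lemma cadlag_comp_mult:
  assumes carried: "AE t in path_measure y. 0 \<le> t \<longrightarrow> x t = (0::real)"
    and x: "cadlag x" and f: "locally_bounded f"
  shows "cadlag (\<lambda>t. f (y t) * x t)"
  unfolding cadlag_def
proof (intro conjI allI impI)
  have bnd: "\<exists>k. \<forall>t. 0 \<le> t \<longrightarrow> t \<le> v \<longrightarrow> norm (f (y t)) \<le> k" for v
  proof -
    have "bounded (f ` {y 0..y v})" using f by (auto simp: locally_bounded_def)
    then obtain k where "\<forall>z\<in>{y 0..y v}. norm (f z) \<le> k" by (auto simp: bounded_iff)
    then show ?thesis by (intro exI[of _ k]) (auto intro!: path_mono[OF cont mono])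
  qed
  fix t :: real
  show "((\<lambda>t. f (y t) * x t) \<longlongrightarrow> f (y t) * x t) (at_right t)" if t: "0 \<le> t"
  proof (cases "x t = 0")
    case True
    obtain k where k: "\<And>s. 0 \<le> s \<Longrightarrow> s \<le> t + 1 \<Longrightarrow> norm (f (y s)) \<le> k" using bnd[of "t + 1"] by auto
    have "\<forall>\<^sub>F s in at_right t. norm (f (y s)) \<le> k"
      using eventually_at_right_real[of t "t + 1"] by (rule eventually_mono) (use k t in auto)
    then have "((\<lambda>t. f (y t) * x t) \<longlongrightarrow> 0) (at_right t)"
      using cadlag_right[OF x t] True
      by (intro lim_null_mult_left_bounded[where B=k] ) auto
    then show ?thesis using True by simp
  next
    case False
    then have "\<forall>\<^sub>F s in at_right t. x s \<noteq> 0"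
      by (rule tendsto_imp_eventually_ne[OF cadlag_right[OF x t]])
    then obtain v where v: "t < v" "\<And>s. t < s \<Longrightarrow> s < v \<Longrightarrow> x s \<noteq> 0"
      by (auto simp: eventually_at_right_field)
    have "y s = y t" if "t < s" "s < v" for s
      by (rule path_measure_carried_imp[OF carried t]) (use v False that in \<open>force simp: less_eq_real_def\<close>)+
    then have "\<forall>\<^sub>F s in at_right t. f (y t) * x s = f (y s) * x s"
      using eventually_at_right_real[OF v(1)] by (auto elim!: eventually_mono)
    moreover have "((\<lambda>s. f (y t) * x s) \<longlongrightarrow> f (y t) * x t) (at_right t)"
      by (intro tendsto_intros cadlag_right[OF x t])
    ultimately show ?thesis by (rule Lim_transform_eventually[rotated])
  qed
  show "\<exists>l. ((\<lambda>t. f (y t) * x t) \<longlongrightarrow> l) (at_left t)" if t: "0 < t"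
  proof -
    obtain l where l: "(x \<longlongrightarrow> l) (at_left t)" using x t by (auto simp: cadlag_def)
    show ?thesis
    proof (cases "l = 0")
      case True
      obtain k where k: "\<And>s. 0 \<le> s \<Longrightarrow> s \<le> t \<Longrightarrow> norm (f (y s)) \<le> k" using bnd[of t] by auto
      have "\<forall>\<^sub>F s in at_left t. norm (f (y s)) \<le> k"
        using eventually_at_left_real[OF t] by (rule eventually_mono) (use k in auto)
      then have "((\<lambda>t. f (y t) * x t) \<longlongrightarrow> 0) (at_left t)"
        using l True by (intro lim_null_mult_left_bounded[where B=k]) auto
      then show ?thesis by blast
    next
      case False
      have "\<forall>\<^sub>F s in at_left t. x s \<noteq> 0 \<and> s \<in> {0<..<t}"
        using tendsto_imp_eventually_ne[OF l False] eventually_at_left_real[OF t]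
        by eventually_elim auto
      then obtain b where b: "b < t" "\<And>s. b < s \<Longrightarrow> s < t \<Longrightarrow> x s \<noteq> 0 \<and> 0 < s"
        by (auto simp: eventually_at_left_field)
      define m where "m = (b + t) / 2"
      have m: "b < m" "m < t" using b(1) by (auto simp: m_def)
      have const: "y s = y m" if s: "m \<le> s" "s < t" for s
      proof (rule path_measure_carried_imp[OF carried _ s(1)])
        show "0 \<le> m" using b(2)[OF m] by simp
        show "x r \<noteq> 0" if "m \<le> r" "r \<le> s" for r
          using b(2)[of r] that m s by simp
      qed
      have "\<forall>\<^sub>F s in at_left t. f (y m) * x s = f (y s) * x s"
        using eventually_at_left_real[OF m(2)]
      proof (rule eventually_mono)
        fix s assume "s \<in> {m<..<t}"
        then have "y s = y m" by (intro const) auto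
        then show "f (y m) * x s = f (y s) * x s" by simp
      qed
      moreover have "((\<lambda>s. f (y m) * x s) \<longlongrightarrow> f (y m) * l) (at_left t)"
        by (intro tendsto_intros l)
      ultimately show ?thesis by (blast intro: Lim_transform_eventually)
    qed
  qed
qed

text \<open>Suppose that \<open>x t\<close> is nonzero and \<open>y\<close> increases right after
  \<open>t\<close>. Choose \<open>w\<close> so close to \<open>t\<close> that \<open>x\<close> has
  no zero on \<open>[t, w]\<close>, and a rational \<open>q\<close> strictly between
  \<open>y t\<close> and \<open>y w\<close>; a rational one, because only countably many levels are
  available almost surely. Its level time \<open>r\<close> lies in \<open>[t, w)\<close>, and the
  indicator is \<open>0\<close> at \<open>r\<close> but \<open>1\<close> just after it.
  Right-continuity of the product then forces \<open>x r = 0\<close>, a contradiction.\<close>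

lemma right_limits_imp_constant:
  assumes x: "cadlag x" and y0: "y 0 = 0"
    and ind: "\<And>q u. q \<in> \<rat> \<Longrightarrow> 0 \<le> u \<Longrightarrow>
      ((\<lambda>t. indicator {q<..} (y t) * x t) \<longlongrightarrow> indicator {q<..} (y u) * x u) (at_right u)"
    and t: "0 \<le> t" "x t \<noteq> (0::real)"
  shows "\<exists>v>t. y v = y t"
proof (rule ccontr)
  assume "\<not> ?thesis"
  then have inc: "y t < y v" if "t < v" for v
    using path_mono[OF cont mono t(1), of v] that by force
  have "\<forall>\<^sub>F s in at_right t. x s \<noteq> 0"
    by (rule tendsto_imp_eventually_ne[OF cadlag_right[OF x t(1)] t(2)])
  then obtain v where v: "t < v" "\<And>s. t < s \<Longrightarrow> s < v \<Longrightarrow> x s \<noteq> 0"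
    by (auto simp: eventually_at_right_field)
  define w where "w = (t + v) / 2"
  have w: "t < w" "w < v" using v(1) by (auto simp: w_def)
  obtain q where q: "q \<in> \<rat>" "y t < q" "q < y w" using Rats_dense_in_real[OF inc[OF w(1)]] by auto
  define r where "r = level_time y q w"
  have "y 0 \<le> q" using path_mono[OF cont mono, of 0 t] t q by auto
  note r = level_time_eq[OF cont mono this _ order_refl q(3), folded r_def]
  have tr: "t \<le> r" unfolding r_def using q w t by (intro level_time_upper[OF cont mono]) auto
  have r': "r < w" "y r = q" "\<And>s. r < s \<Longrightarrow> q < y s" using r w t by auto
  have xr: "x r \<noteq> 0" using v(2)[of r] t(2) tr r'(1) w by (cases "t = r") auto
  have "((\<lambda>s. indicator {q<..} (y s) * x s) \<longlongrightarrow> 0) (at_right r)"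
    using ind[OF q(1), of r] tr t r' by simp
  moreover have "\<forall>\<^sub>F s in at_right r. indicator {q<..} (y s) * x s = x s"
    using eventually_at_right_less[of r] by (rule eventually_mono) (simp add: r'(3))
  ultimately have "(x \<longlongrightarrow> 0) (at_right r)" by (rule Lim_transform_eventually)
  moreover have "(x \<longlongrightarrow> x r) (at_right r)" using x tr t by (auto intro: cadlag_right)
  ultimately show False using xr tendsto_unique[of "at_right r" x] by (auto simp: trivial_limit_at_right_real)
qed

end

text \<open>One of the two integrals always vanishes, a single point being null. Both signs of
  \<open>y\<close> are covered because adaptedness concerns every \<omega>, including the null set
  on which the increasing process may be negative.\<close>

lemma interval_integral_eq_Icc:
  fixes f :: "real \<Rightarrow> real"
  shows "(LBINT z=0..y. f z) = (LBINT z:{0..y}. f z) - (LBINT z:{y..0}. f z)"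
proof (cases "0 \<le> y")
  case True
  then have "(LBINT z=0..y. f z) = (LBINT z:{0..y}. f z)"
    using interval_integral_Icc[of 0 y f] by (simp add: zero_ereal_def)
  moreover have "(LBINT z:{y..0}. f z) = 0"
  proof -
    have "AE z in lborel. z \<noteq> (0::real)" by (rule AE_lborel_singleton)
    then have "AE z in lborel. indicator {y..0} z *\<^sub>R f z = 0"
      by eventually_elim (use True in \<open>auto simp: indicator_def\<close>)
    then show ?thesis unfolding set_lebesgue_integral_def by (rule integral_eq_zero_AE)
  qed
  ultimately show ?thesis by simp
next
  case False
  then have "(LBINT z=0..y. f z) = - (LBINT z=y..0. f z)"
    by (subst interval_integral_endpoints_reverse) simp
  also have "\<dots> = - (LBINT z:{y..0}. f z)"
    using False interval_integral_Icc[of y 0 f] by (simp add: zero_ereal_def)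
  finally show ?thesis using False by (simp add: set_lebesgue_integral_def)
qed

lemma interval_integral_eq_Icc_nonneg:
  fixes f :: "real \<Rightarrow> real"
  shows "0 \<le> y \<Longrightarrow> (LBINT z=0..y. f z) = (LBINT z:{0..y}. f z)"
  using interval_integral_Icc[of 0 y f] by (simp add: zero_ereal_def)

text \<open>The primitive is Lipschitz on each \<open>{0..<b}\<close>, with the bound of
  \<open>f\<close> on \<open>{0..b}\<close> as constant, and continuity is a local property.\<close>

lemma continuous_on_Icc_integral:
  fixes f :: "real \<Rightarrow> real"
  assumes f: "f \<in> borel_measurable borel" "locally_bounded f"
  shows "continuous_on {0..} (\<lambda>y. LBINT z:{0..y}. f z)"
proof -
  have "continuous_on {0..<b} (\<lambda>y. LBINT z:{0..y}. f z)" for b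
  proof -
    have "bounded (f ` {0..b})" using f by (auto simp: locally_bounded_def)
    then obtain k where "\<forall>z\<in>{0..b}. \<bar>f z\<bar> \<le> k" by (auto simp: bounded_iff)
    then have k: "\<And>z. z \<in> {0..b} \<Longrightarrow> \<bar>f z\<bar> \<le> k" by blast
    have *: "dist (LBINT z:{0..u}. f z) (LBINT z:{0..v}. f z) \<le> k * dist u v"
      if uv: "0 \<le> u" "u \<le> v" "v \<le> b" for u v
    proof -
      have s: "set_integrable lborel {0..u} f" "set_integrable lborel {u..v} f"
        by (rule set_integrable_Icc_bounded[OF f(1), of _ _ k]; use uv k in auto)+
      have "AE z in lborel. \<not> (z \<in> {0..u} \<and> z \<in> {u..v})"
        by (rule eventually_mono[OF AE_lborel_singleton[of u]]) auto
      from set_integral_Un_AE[OF this _ _ s]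
      have "(LBINT z:{0..u} \<union> {u..v}. f z) = (LBINT z:{0..u}. f z) + (LBINT z:{u..v}. f z)" by simp
      moreover have "{0..u} \<union> {u..v} = {0..v}" using uv by auto
      ultimately have "(LBINT z:{0..v}. f z) = (LBINT z:{0..u}. f z) + (LBINT z:{u..v}. f z)" by simp
      moreover have "\<bar>LBINT z:{u..v}. f z\<bar> \<le> k * (v - u)"
        by (rule abs_Icc_integral_le[OF f(1)]) (use uv k in auto)
      ultimately show ?thesis using uv by (simp add: dist_real_def)
    qed
    have k0: "0 \<le> k \<or> b < 0" using k[of 0] by (cases "0 \<le> b") auto
    show ?thesis
    proof (rule lipschitz_on_continuous_on[of "max 0 k"], rule lipschitz_onI)
      fix u v assume "u \<in> {0..<b}" "v \<in> {0..<b}"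
      then show "dist (LBINT z:{0..u}. f z) (LBINT z:{0..v}. f z) \<le> max 0 k * dist u v"
        using *[of u v] *[of v u] k0
        by (cases "u \<le> v") (auto simp: dist_commute max_def)
    qed simp
  qed note cont = this
  show ?thesis
  proof (rule continuous_on_eq_continuous_within[THEN iffD2], rule ballI)
    fix x :: real assume x: "x \<in> {0..}"
    have "continuous (at x within {0..<x+1}) (\<lambda>y. LBINT z:{0..y}. f z)"
      using cont[of "x + 1"] x by (auto simp: continuous_on_eq_continuous_within)
    moreover have "at x within {0..<x+1} = at x within {0..}"
      by (rule at_within_nhd[of _ "{..<x+1}"]) (use x in auto)
    ultimately show "continuous (at x within {0..}) (\<lambda>y. LBINT z:{0..y}. f z)" by simp
  qed
qed

lemma cadlag_cong:
  assumes "\<And>t. 0 \<le> t \<Longrightarrow> x t = y t"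
  shows "cadlag x \<longleftrightarrow> cadlag y"
proof -
  have "(x \<longlongrightarrow> x t) (at_right t) \<longleftrightarrow> (y \<longlongrightarrow> y t) (at_right t)" if t: "0 \<le> t" for t
  proof -
    have "\<forall>\<^sub>F s in at_right t. x s = y s"
      using eventually_at_right_less[of t] by (rule eventually_mono) (use assms t in auto)
    then show ?thesis using assms[OF t] by (simp add: tendsto_cong)
  qed
  moreover have "(x \<longlongrightarrow> l) (at_left t) \<longleftrightarrow> (y \<longlongrightarrow> l) (at_left t)" if t: "0 < t" for t l
    by (rule tendsto_cong, rule eventually_mono[OF eventually_at_left_real[OF t]]) (use assms in auto)
  ultimately show ?thesis by (auto simp: cadlag_def)
qed

lemma cadlag_diff: "cadlag x \<Longrightarrow> cadlag y \<Longrightarrow> cadlag (\<lambda>t. x t - y t)"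
  unfolding cadlag_def by (blast intro: tendsto_diff)

lemma continuous_on_imp_cadlag: "continuous_on {0..} y \<Longrightarrow> cadlag y"
  unfolding cadlag_def using continuous_on_Ici_limits by (meson less_imp_le)

section \<open>Continuous martingales of finite variation\<close>

text \<open>The sum of squares is at most the largest increment times the total increase, and the
  largest increment tends to 0 by uniform continuity.\<close>

lemma sum_power2_increments:
  fixes w :: "real \<Rightarrow> real"
  assumes w: "continuous_on {0..} w" "mono_on {0..} w" and t: "0 \<le> t"
  defines "q \<equiv> \<lambda>m. \<Sum>i<Suc m. (w (grid 0 t (Suc m) (Suc i)) - w (grid 0 t (Suc m) i))\<^sup>2"
  shows "q m \<le> (w t - w 0)\<^sup>2" and "q \<longlonglongrightarrow> 0"
proof -
  define d where "d m i = w (grid 0 t (Suc m) (Suc i)) - w (grid 0 t (Suc m) i)" for m i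
  have g0: "0 \<le> grid 0 t m i" for m i using grid_ge[OF t] .
  have d0: "0 \<le> d m i" for m i
    unfolding d_def using path_mono[OF w g0 grid_mono[OF t], of i "Suc i"] by simp
  have sumd: "(\<Sum>i<Suc m. d m i) = w t - w 0" for m
    unfolding d_def by (subst sum_lessThan_telescope) simp
  have le: "q m \<le> e * (w t - w 0)" if "\<And>i. i < Suc m \<Longrightarrow> d m i \<le> e" for m e
  proof -
    have "q m = (\<Sum>i<Suc m. d m i * d m i)" by (simp only: q_def d_def power2_eq_square)
    also have "\<dots> \<le> (\<Sum>i<Suc m. e * d m i)"
      using that d0 by (intro sum_mono mult_right_mono) auto
    finally show ?thesis by (simp only: sum_distrib_left[symmetric] sumd)
  qed
  have q0: "0 \<le> q m" for m unfolding q_def by (intro sum_nonneg) simp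
  have "d m i \<le> w t - w 0" if "i < Suc m" for m i
    unfolding sumd[of m, symmetric] using that d0 by (intro member_le_sum) auto
  from le[OF this] show "q m \<le> (w t - w 0)\<^sup>2" by (simp add: power2_eq_square)
  show "q \<longlonglongrightarrow> 0"
  proof (rule LIMSEQ_I)
    fix r :: real assume r: "0 < r"
    have wt: "0 \<le> w t - w 0" using path_mono[OF w, of 0 t] t by simp
    \<comment> \<open>The summand \<open>1\<close> keeps the denominator positive when
      \<open>w t = w 0\<close>.\<close>
    define e where "e = r / (w t - w 0 + 1)"
    have e: "0 < e" "e * (w t - w 0) < r"
      using r wt by (auto simp: e_def field_simps)
    have "uniformly_continuous_on {0..t} w"
      by (intro compact_uniformly_continuous continuous_on_subset[OF w(1)]) auto
    then obtain \<delta> where \<delta>: "0 < \<delta>" "\<And>u v. u \<in> {0..t} \<Longrightarrow> v \<in> {0..t} \<Longrightarrow> dist u v < \<delta> \<Longrightarrow> dist (w u) (w v) < e"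
      using e(1) unfolding uniformly_continuous_on_def by meson
    obtain m0 :: nat where m0: "t / \<delta> < real m0" using reals_Archimedean2 by blast
    show "\<exists>m0. \<forall>m\<ge>m0. norm (q m - 0) < r"
    proof (intro exI allI impI)
      fix m assume m: "m \<ge> m0"
      have "d m i \<le> e" if i: "i < Suc m" for i
      proof -
        have "t / \<delta> < real (Suc m)" using m0 m by simp
        then have "t / real (Suc m) < \<delta>" using \<delta>(1) by (simp add: field_simps)
        moreover have "dist (grid 0 t (Suc m) (Suc i)) (grid 0 t (Suc m) i) = t / real (Suc m)"
          using t by (simp add: dist_real_def grid_Suc)
        ultimately have "dist (w (grid 0 t (Suc m) (Suc i))) (w (grid 0 t (Suc m) i)) < e"
          using i g0 grid_le[OF t, of _ "Suc m"] by (intro \<delta>(2)) auto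
        then show ?thesis by (simp add: d_def dist_real_def)
      qed
      from le[OF this] e(2) q0[of m] show "norm (q m - 0) < r" by simp
    qed
  qed
qed

context filtered_prob_space
begin

lemma martingale_square_increment:
  assumes D: "martingale M F D" and b: "AE \<omega> in M. \<forall>t\<ge>0. \<bar>D t \<omega>\<bar> \<le> k" and st: "0 \<le> s" "s \<le> t"
  shows "(\<integral>\<omega>. (D t \<omega>)\<^sup>2 - (D s \<omega>)\<^sup>2 \<partial>M) = (\<integral>\<omega>. (D t \<omega> - D s \<omega>)\<^sup>2 \<partial>M)"
proof -
  have t: "0 \<le> t" using st by simp
  have [measurable]: "D s \<in> borel_measurable (F s)"
    using adaptedD[OF martingaleD(1)[OF D]] st by auto
  have Dm[measurable]: "D s \<in> borel_measurable M" "D t \<in> borel_measurable M"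
    using martingaleD(2)[OF D] st t by auto
  have i: "integrable M (\<lambda>\<omega>. D u \<omega> * D v \<omega>)" if uv: "0 \<le> u" "0 \<le> v" for u v
  proof (rule integrable_const_bound[where B="k * k"])
    show "AE \<omega> in M. norm (D u \<omega> * D v \<omega>) \<le> k * k"
      using b by eventually_elim (use uv in \<open>auto simp: abs_mult intro!: mult_mono intro: order_trans[OF abs_ge_zero]\<close>)
    show "(\<lambda>\<omega>. D u \<omega> * D v \<omega>) \<in> borel_measurable M"
      using martingaleD(2)[OF D] uv by measurable
  qed
  \<comment> \<open>\<open>D s\<close> is bounded only almost surely, whereas a multiplier has to be
    bounded everywhere. The truncation is still measurable with respect to \<open>F s\<close>; the
    sign of \<open>k\<close> is not known, hence the bound \<open>\<bar>k\<bar>\<close>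
    below.\<close>
  define h where "h \<omega> = max (- k) (min k (D s \<omega>))" for \<omega>
  have hD: "AE \<omega> in M. h \<omega> = D s \<omega>"
    using b by eventually_elim (use st in \<open>auto simp: h_def abs_le_iff max_def min_def\<close>)
  have "(\<integral>\<omega>. h \<omega> * D t \<omega> \<partial>M) = (\<integral>\<omega>. h \<omega> * D s \<omega> \<partial>M)"
    by (rule martingale_integral_mult(1)[OF D st, of _ "\<bar>k\<bar>"]) (auto simp: h_def)
  moreover have "(\<integral>\<omega>. h \<omega> * D v \<omega> \<partial>M) = (\<integral>\<omega>. D s \<omega> * D v \<omega> \<partial>M)" if v: "0 \<le> v" for v
    by (rule integral_cong_AE)
      (use martingaleD(2)[OF D v] hD in \<open>auto simp: h_def[abs_def] intro!: borel_measurable_times\<close>)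
  ultimately have eq: "(\<integral>\<omega>. D s \<omega> * D t \<omega> \<partial>M) = (\<integral>\<omega>. D s \<omega> * D s \<omega> \<partial>M)"
    using st t by simp
  have "(\<integral>\<omega>. (D t \<omega> - D s \<omega>)\<^sup>2 \<partial>M) = (\<integral>\<omega>. (D t \<omega> * D t \<omega> - D s \<omega> * D s \<omega>) - 2 * (D s \<omega> * D t \<omega> - D s \<omega> * D s \<omega>) \<partial>M)"
    by (rule Bochner_Integration.integral_cong) (auto simp: power2_eq_square algebra_simps)
  also have "\<dots> = (\<integral>\<omega>. D t \<omega> * D t \<omega> - D s \<omega> * D s \<omega> \<partial>M) - 2 * 0"
    using i[OF t t] i[OF st(1) st(1)] i[OF st(1) t] eq by simp
  finally show ?thesis by (simp add: power2_eq_square)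
qed

text \<open>By orthogonality of increments, the second moment of \<open>D t\<close> is the expected
  sum of squared increments along every grid. These sums are bounded and tend to 0 for paths that
  are differences of continuous increasing functions. Since \<open>p\<close> and \<open>q\<close>
  are chosen separately for each \<omega>, their measurability does not arise.\<close>

lemma continuous_finite_variation_martingale:
  assumes D: "martingale M F D"
    and pq: "AE \<omega> in M. \<exists>p q. continuous_on {0..} p \<and> continuous_on {0..} q \<and> mono_on {0..} p \<and> mono_on {0..} q \<and>
      (\<forall>t\<ge>0. 0 \<le> p t \<and> p t \<le> k \<and> 0 \<le> q t \<and> q t \<le> k \<and> D t \<omega> = p t - q t)"
    and D0: "AE \<omega> in M. D 0 \<omega> = 0" and t: "0 \<le> t"
  shows "AE \<omega> in M. D t \<omega> = 0"
proof -
  have b: "AE \<omega> in M. \<forall>t\<ge>0. \<bar>D t \<omega>\<bar> \<le> k"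
    using pq by eventually_elim fastforce
  have Dm: "D u \<in> borel_measurable M" if "0 \<le> u" for u
    using martingaleD(2)[OF D that] by auto
  define Q where "Q m \<omega> = (\<Sum>i<Suc m. (D (grid 0 t (Suc m) (Suc i)) \<omega> - D (grid 0 t (Suc m) i) \<omega>)\<^sup>2)" for m \<omega>
  have g0: "0 \<le> grid 0 t m i" for m i using grid_ge[OF t] .
  have sq_int: "integrable M (\<lambda>\<omega>. (D u \<omega>)\<^sup>2)" if u: "0 \<le> u" for u
  proof (rule integrable_const_bound[where B="k\<^sup>2"])
    show "AE \<omega> in M. norm ((D u \<omega>)\<^sup>2) \<le> k\<^sup>2"
      using b by eventually_elim (use u in \<open>auto simp: abs_le_square_iff[symmetric]\<close>)
  qed (use Dm[OF u] in measurable)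
  have diff_int: "integrable M (\<lambda>\<omega>. (D u \<omega> - D v \<omega>)\<^sup>2)" if uv: "0 \<le> u" "0 \<le> v" for u v
  proof (rule integrable_const_bound[where B="(2 * k)\<^sup>2"])
    show "AE \<omega> in M. norm ((D u \<omega> - D v \<omega>)\<^sup>2) \<le> (2 * k)\<^sup>2"
      using b
    proof eventually_elim
      case (elim \<omega>)
      then have "\<bar>D u \<omega>\<bar> \<le> k" "\<bar>D v \<omega>\<bar> \<le> k" using uv by auto
      then have "\<bar>D u \<omega> - D v \<omega>\<bar> \<le> \<bar>2 * k\<bar>" by linarith
      then show ?case by (simp only: abs_le_square_iff) simp
    qed
  qed (use Dm[OF uv(1)] Dm[OF uv(2)] in measurable)
  have EQ: "(\<integral>\<omega>. Q m \<omega> \<partial>M) = (\<integral>\<omega>. (D t \<omega>)\<^sup>2 \<partial>M)" for m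
  proof -
    let ?g = "grid 0 t (Suc m)"
    have "(\<integral>\<omega>. Q m \<omega> \<partial>M) = (\<Sum>i<Suc m. \<integral>\<omega>. (D (?g (Suc i)) \<omega> - D (?g i) \<omega>)\<^sup>2 \<partial>M)"
      unfolding Q_def by (rule Bochner_Integration.integral_sum) (intro diff_int g0)
    also have "\<dots> = (\<Sum>i<Suc m. (\<integral>\<omega>. (D (?g (Suc i)) \<omega>)\<^sup>2 \<partial>M) - (\<integral>\<omega>. (D (?g i) \<omega>)\<^sup>2 \<partial>M))"
    proof (intro sum.cong refl)
      fix i
      have "(\<integral>\<omega>. (D (?g (Suc i)) \<omega> - D (?g i) \<omega>)\<^sup>2 \<partial>M) = (\<integral>\<omega>. (D (?g (Suc i)) \<omega>)\<^sup>2 - (D (?g i) \<omega>)\<^sup>2 \<partial>M)"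
        by (rule martingale_square_increment[OF D b, symmetric]) (auto intro: g0 grid_mono t)
      then show "(\<integral>\<omega>. (D (?g (Suc i)) \<omega> - D (?g i) \<omega>)\<^sup>2 \<partial>M)
          = (\<integral>\<omega>. (D (?g (Suc i)) \<omega>)\<^sup>2 \<partial>M) - (\<integral>\<omega>. (D (?g i) \<omega>)\<^sup>2 \<partial>M)"
        using sq_int[OF g0] by simp
    qed
    also have "\<dots> = (\<integral>\<omega>. (D (?g (Suc m)) \<omega>)\<^sup>2 \<partial>M) - (\<integral>\<omega>. (D (?g 0) \<omega>)\<^sup>2 \<partial>M)"
      by (rule sum_lessThan_telescope)
    also have "(\<integral>\<omega>. (D (?g 0) \<omega>)\<^sup>2 \<partial>M) = 0"
      by (rule integral_eq_zero_AE) (use D0 in auto)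
    finally show ?thesis by simp
  qed
  have Qb: "AE \<omega> in M. (\<forall>m. \<bar>Q m \<omega>\<bar> \<le> (2 * k)\<^sup>2) \<and> (\<lambda>m. Q m \<omega>) \<longlonglongrightarrow> 0"
    using pq
  proof eventually_elim
    case (elim \<omega>)
    then obtain p q where p: "continuous_on {0..} p" "mono_on {0..} p"
      and q: "continuous_on {0..} q" "mono_on {0..} q"
      and bd: "\<And>t. t \<ge> 0 \<Longrightarrow> 0 \<le> p t \<and> p t \<le> k \<and> 0 \<le> q t \<and> q t \<le> k \<and> D t \<omega> = p t - q t"
      by blast
    \<comment> \<open>Increments of \<open>p - q\<close> are bounded by those of the monotone
      function \<open>p + q\<close>, whose total increase is at most \<open>2 * k\<close>; hence the
      bound \<open>(2 * k)\<^sup>2\<close>.\<close>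
    define w where "w t = p t + q t" for t
    have w: "continuous_on {0..} w" "mono_on {0..} w"
      using p q by (auto simp: w_def[abs_def] mono_on_def intro!: continuous_intros add_mono)
    note sp = sum_power2_increments[OF w t]
    let ?q = "\<lambda>m. \<Sum>i<Suc m. (w (grid 0 t (Suc m) (Suc i)) - w (grid 0 t (Suc m) i))\<^sup>2"
    have Qq: "Q m \<omega> \<le> ?q m" for m
      unfolding Q_def
    proof (intro sum_mono)
      fix i
      let ?u = "grid 0 t (Suc m) i" and ?v = "grid 0 t (Suc m) (Suc i)"
      have "?u \<le> ?v" by (intro grid_mono t) simp
      then have "p ?u \<le> p ?v" "q ?u \<le> q ?v" using path_mono[OF p g0] path_mono[OF q g0] by auto
      then have "\<bar>D ?v \<omega> - D ?u \<omega>\<bar> \<le> \<bar>w ?v - w ?u\<bar>" using bd[OF g0] by (simp add: w_def)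
      then show "(D ?v \<omega> - D ?u \<omega>)\<^sup>2 \<le> (w ?v - w ?u)\<^sup>2" by (simp only: abs_le_square_iff)
    qed
    have Q0: "0 \<le> Q m \<omega>" for m unfolding Q_def by (intro sum_nonneg) simp
    have "\<bar>w t - w 0\<bar> \<le> \<bar>2 * k\<bar>" using bd[OF t] bd[of 0] unfolding w_def by (smt (verit))
    then have "(w t - w 0)\<^sup>2 \<le> (2 * k)\<^sup>2" by (simp only: abs_le_square_iff)
    then have "\<bar>Q m \<omega>\<bar> \<le> (2 * k)\<^sup>2" for m using Qq[of m] Q0[of m] sp(1)[of m] by linarith
    moreover have "(\<lambda>m. Q m \<omega>) \<longlonglongrightarrow> 0"
      by (rule tendsto_sandwich[OF _ _ tendsto_const sp(2)]) (use Q0 Qq in auto)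
    ultimately show ?case by blast
  qed
  have "(\<lambda>m. \<integral>\<omega>. Q m \<omega> \<partial>M) \<longlonglongrightarrow> (\<integral>\<omega>. 0 \<partial>M)"
  proof (rule integral_dominated_convergence[where w="\<lambda>_. (2 * k)\<^sup>2"])
    show "Q m \<in> borel_measurable M" for m
      unfolding Q_def using Dm[OF g0] by measurable
    show "AE \<omega> in M. norm (Q m \<omega>) \<le> (2 * k)\<^sup>2" for m using Qb by eventually_elim simp
    show "AE \<omega> in M. (\<lambda>m. Q m \<omega>) \<longlonglongrightarrow> 0" using Qb by eventually_elim simp
  qed auto
  then have "(\<integral>\<omega>. (D t \<omega>)\<^sup>2 \<partial>M) = 0" by (simp add: EQ LIMSEQ_const_iff)
  then have "AE \<omega> in M. (D t \<omega>)\<^sup>2 = 0"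
    using integral_nonneg_eq_0_iff_AE[OF sq_int[OF t]] by simp
  then show ?thesis by simp
qed

section \<open>Localizing sequences\<close>

lemma localizing_sequenceD:
  assumes "localizing_sequence M F T"
  shows "stopping_time F (T n)" "\<And>\<omega>. \<omega> \<in> space M \<Longrightarrow> 0 \<le> T n \<omega>"
    "AE \<omega> in M. incseq (\<lambda>n. T n \<omega>) \<and> filterlim (\<lambda>n. T n \<omega>) at_top sequentially"
  using assms unfolding localizing_sequence_def by auto

lemma localizing_sequence_min:
  assumes T: "localizing_sequence M F T" and S: "localizing_sequence M F S"
  shows "localizing_sequence M F (\<lambda>n \<omega>. min (T n \<omega>) (S n \<omega>))"
  unfolding localizing_sequence_def
proof (intro conjI allI ballI)
  fix n
  show "stopping_time F (\<lambda>\<omega>. min (T n \<omega>) (S n \<omega>))"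
    by (intro stopping_time_min localizing_sequenceD[OF T] localizing_sequenceD[OF S])
  show "0 \<le> min (T n \<omega>) (S n \<omega>)" if "\<omega> \<in> space M" for \<omega>
    using localizing_sequenceD(2)[OF T that] localizing_sequenceD(2)[OF S that] by simp
next
  show "AE \<omega> in M. incseq (\<lambda>n. min (T n \<omega>) (S n \<omega>)) \<and> filterlim (\<lambda>n. min (T n \<omega>) (S n \<omega>)) at_top sequentially"
    using localizing_sequenceD(3)[OF T] localizing_sequenceD(3)[OF S]
  proof eventually_elim
    case (elim \<omega>)
    have "incseq (\<lambda>n. min (T n \<omega>) (S n \<omega>))"
      using elim by (auto simp: incseq_def min_le_iff_disj)
    moreover have "filterlim (\<lambda>n. min (T n \<omega>) (S n \<omega>)) at_top sequentially"
      unfolding filterlim_at_top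
    proof
      fix z
      have "\<forall>\<^sub>F n in sequentially. z \<le> T n \<omega>" "\<forall>\<^sub>F n in sequentially. z \<le> S n \<omega>"
        using elim by (auto simp: filterlim_at_top)
      then show "\<forall>\<^sub>F n in sequentially. z \<le> min (T n \<omega>) (S n \<omega>)" by eventually_elim simp
    qed
    ultimately show ?case by blast
  qed
qed

lemma continuous_increasing_processD:
  assumes "continuous_increasing_process M F a"
  shows "adapted F a" "\<And>\<omega>. \<omega> \<in> space M \<Longrightarrow> continuous_on {0..} (\<lambda>t. a t \<omega>)"
    "\<And>\<omega>. \<omega> \<in> space M \<Longrightarrow> mono_on {0..} (\<lambda>t. a t \<omega>)"
  using assms by (auto simp: continuous_increasing_process_def)

text \<open>The level \<open>n\<close> bounds the stopped process if it starts at or below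
  \<open>n\<close>, and the cap \<open>n\<close> keeps the times finite. As soon as \<open>n\<close>
  exceeds both \<open>z\<close> and the value of the process at \<open>z\<close>, for
  \<open>z\<close> at least 0, the time is at least \<open>z\<close>.\<close>

lemma localizing_sequence_level:
  assumes a: "continuous_increasing_process M F a"
  shows "localizing_sequence M F (\<lambda>n \<omega>. strict_level_time (\<lambda>t. a t \<omega>) (real n) (real n))"
  unfolding localizing_sequence_def
proof (intro conjI allI ballI AE_I2)
  note a = continuous_increasing_processD[OF a]
  fix n :: nat
  let ?S = "\<lambda>\<omega>. strict_level_time (\<lambda>t. a t \<omega>) (real n) (real n)"
  show "stopping_time F ?S"
  proof
    fix u :: real
    have "{\<omega>\<in>space M. ?S \<omega> \<le> u} \<in> sets (F u)"
    proof -
      consider "u < 0" | "0 \<le> u" "u < real n" | "real n \<le> u" by linarith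
      then show ?thesis
      proof cases
        case 1
        then have "\<not> ?S \<omega> \<le> u" for \<omega>
          using strict_level_time_bounds(1)[of "real n" "\<lambda>t. a t \<omega>" "real n"] by simp
        then have "{\<omega>\<in>space M. ?S \<omega> \<le> u} = {}" by blast
        then show ?thesis by (simp only: sets.empty_sets)
      next
        case 2
        then have "{\<omega>\<in>space M. ?S \<omega> \<le> u} = {\<omega>\<in>space (F u). real n \<le> a u \<omega>}"
          using strict_level_time_le_iff[OF a(2) a(3) 2] by (auto simp: space_F)
        also have "\<dots> \<in> sets (F u)" using adaptedD[OF a(1) 2(1)] by measurable
        finally show ?thesis .
      next
        case 3
        then have "?S \<omega> \<le> u" for \<omega>
          using strict_level_time_bounds(2)[of "real n" "\<lambda>t. a t \<omega>" "real n"] by simp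
        then have "{\<omega>\<in>space M. ?S \<omega> \<le> u} = space (F u)" by (auto simp: space_F)
        then show ?thesis by (simp only: sets.top)
      qed
    qed
    then show "Measurable.pred (F u) (\<lambda>\<omega>. ?S \<omega> \<le> u)" by (simp add: pred_def space_F)
  qed
  show "0 \<le> ?S \<omega>" for \<omega> by (rule strict_level_time_bounds) simp
next
  note a = continuous_increasing_processD[OF a]
  fix \<omega> assume \<omega>: "\<omega> \<in> space M"
  show "incseq (\<lambda>n. strict_level_time (\<lambda>t. a t \<omega>) (real n) (real n))"
    unfolding incseq_def strict_level_time_def
  proof (intro allI impI cSup_subset_mono)
    fix m n :: nat assume "m \<le> n"
    then show "insert 0 {u \<in> {0..real m}. a u \<omega> < real m} \<subseteq> insert 0 {u \<in> {0..real n}. a u \<omega> < real n}"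
      by (auto intro: order_trans less_le_trans)
    show "bdd_above (insert 0 {u \<in> {0..real n}. a u \<omega> < real n})"
      by (rule bdd_aboveI[of _ "real n"]) auto
  qed simp
  show "filterlim (\<lambda>n. strict_level_time (\<lambda>t. a t \<omega>) (real n) (real n)) at_top sequentially"
    unfolding filterlim_at_top
  proof
    fix z :: real
    obtain n0 :: nat where n0: "max (max z 0) (a (max z 0) \<omega>) < real n0" using reals_Archimedean2 by blast
    show "\<forall>\<^sub>F n in sequentially. z \<le> strict_level_time (\<lambda>t. a t \<omega>) (real n) (real n)"
      using eventually_ge_at_top[of n0]
    proof eventually_elim
      case (elim n)
      then have "max (max z 0) (a (max z 0) \<omega>) < real n" using n0 by (meson less_le_trans of_nat_mono)
      then have "max z 0 \<le> strict_level_time (\<lambda>t. a t \<omega>) (real n) (real n)"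
        by (intro strict_level_time_upper[OF a(2)[OF \<omega>] a(3)[OF \<omega>]]) auto
      then show ?case by simp
    qed
  qed
qed

end

section \<open>Characterization of the class \<Sigma>\<close>

context filtered_prob_space
begin

lemma local_martingale_null_at_0E:
  assumes "local_martingale_null_at_0 M F Y"
  obtains T where "localizing_sequence M F T" "\<And>n. martingale M F (stopped (T n) Y)"
    "adapted F Y" "AE \<omega> in M. cadlag (\<lambda>t. Y t \<omega>)" "AE_right_continuous Y" "AE \<omega> in M. Y 0 \<omega> = 0"
proof -
  have c: "AE \<omega> in M. cadlag (\<lambda>t. Y t \<omega>)"
    using assms by (simp add: local_martingale_null_at_0_def local_martingale_def)
  have "AE_right_continuous Y"
    using c unfolding AE_right_continuous_def by eventually_elim (auto intro: cadlag_right)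
  with assms c show ?thesis
    using that unfolding local_martingale_null_at_0_def local_martingale_def by blast
qed

lemma stopped_adapted_cadlag:
  assumes T: "stopping_time F T" "\<And>\<omega>. \<omega> \<in> space M \<Longrightarrow> 0 \<le> T \<omega>"
    and Y: "adapted F Y" "\<And>\<omega>. \<omega> \<in> space M \<Longrightarrow> cadlag (\<lambda>t. Y t \<omega>)"
  shows "adapted F (stopped T Y)"
  by (intro stopped_adapted[OF T(1)] stopped_value_measurable[OF Y(1) cadlag_right[OF Y(2)] T])

lemma Doob_Meyer_decompositionD:
  assumes "Doob_Meyer_decomposition M F X N A"
  shows "AE \<omega> in M. \<forall>t\<ge>0. X t \<omega> = N t \<omega> + A t \<omega>"
    "local_martingale_null_at_0 M F N" "\<And>\<omega>. \<omega> \<in> space M \<Longrightarrow> cadlag (\<lambda>t. N t \<omega>)"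
    "continuous_increasing_process M F A" "AE \<omega> in M. A 0 \<omega> = 0"
  using assms by (auto simp: Doob_Meyer_decomposition_def)

text \<open>The bounded case is applied to the stopped pair \<open>L\<close>, \<open>a\<close>,
  whose sum is the stopped \<open>X\<close> on \<open>{0 < U}\<close>. Almost surely
  \<open>a\<close> takes its values in \<open>{0..n}\<close>, so \<open>f\<close> may be cut off
  outside this interval, which turns local boundedness into boundedness.\<close>

lemma stopped_martingale_transform:
  assumes N: "martingale M F (stopped U N)" "AE_right_continuous N" "AE \<omega> in M. N 0 \<omega> = 0"
    and U: "stopping_time F U" "\<And>\<omega>. \<omega> \<in> space M \<Longrightarrow> 0 \<le> U \<omega>"
    and A: "continuous_increasing_process M F A" "AE \<omega> in M. A 0 \<omega> = 0"
    and An: "AE \<omega> in M. \<forall>t\<ge>0. t \<le> U \<omega> \<longrightarrow> A t \<omega> \<le> n"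
    and X: "adapted F X" "\<And>\<omega>. \<omega> \<in> space M \<Longrightarrow> cadlag (\<lambda>t. X t \<omega>)"
    and XNA: "AE \<omega> in M. \<forall>t\<ge>0. X t \<omega> = N t \<omega> + A t \<omega>"
    and carried: "AE \<omega> in M. AE t in path_measure (\<lambda>t. A t \<omega>). 0 \<le> t \<longrightarrow> X t \<omega> = 0"
    and f: "f \<in> borel_measurable borel" "locally_bounded f"
  shows "martingale M F (stopped U (\<lambda>t \<omega>. (LBINT z=0..A t \<omega>. f z) - f (A t \<omega>) * X t \<omega>))"
proof -
  have [measurable]: "f \<in> borel_measurable borel" by (rule f(1))
  note A' = continuous_increasing_processD[OF A(1)]
  define L where "L = stopped U N"
  define a where "a t \<omega> = A (min (U \<omega>) t) \<omega>" for t \<omega>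
  have aM[measurable]: "a t \<in> borel_measurable (F t)" if "0 \<le> t" for t
    unfolding a_def
    by (rule stopped_value_measurable[OF A'(1) _ U that]) (rule continuous_on_Ici_limits(1)[OF A'(2)])
  have XM: "(\<lambda>\<omega>. X (min (U \<omega>) t) \<omega>) \<in> borel_measurable (F t)" if "0 \<le> t" for t
    by (rule stopped_value_measurable[OF X(1) _ U that]) (rule cadlag_right[OF X(2)])
  have L: "martingale M F L" unfolding L_def by (rule N(1))
  have Lr: "AE_right_continuous L"
    using N(2) unfolding AE_right_continuous_def L_def
    by eventually_elim (auto intro: stopped_right_continuous)
  have a: "adapted F a" by (simp add: adapted_def aM)
  have ac: "continuous_on {0..} (\<lambda>t. a t \<omega>)" if \<omega>: "\<omega> \<in> space M" for \<omega>
    unfolding a_def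
    by (rule continuous_on_compose2[OF A'(2)[OF \<omega>]]) (use U(2)[OF \<omega>] in \<open>auto intro!: continuous_intros\<close>)
  have am: "mono_on {0..} (\<lambda>t. a t \<omega>)" if \<omega>: "\<omega> \<in> space M" for \<omega>
    unfolding a_def using U(2)[OF \<omega>]
    by (auto intro!: mono_onI path_mono[OF A'(2)[OF \<omega>] A'(3)[OF \<omega>]])
  have a0: "AE \<omega> in M. a 0 \<omega> = 0"
    using A(2) AE_space by eventually_elim (use U(2) in \<open>auto simp: a_def min_absorb2\<close>)
  have an: "AE \<omega> in M. \<forall>t\<ge>0. a t \<omega> \<le> n"
    using An AE_space by eventually_elim (use U(2) in \<open>auto simp: a_def\<close>)
  have zero: "AE \<omega> in M. \<forall>u\<ge>0. (\<forall>v>u. a u \<omega> < a v \<omega>) \<longrightarrow> L u \<omega> + a u \<omega> = 0"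
    using carried XNA AE_space
  proof (eventually_elim, intro allI impI)
    fix \<omega> u
    assume c: "AE t in path_measure (\<lambda>t. A t \<omega>). 0 \<le> t \<longrightarrow> X t \<omega> = 0"
      and eq: "\<forall>t\<ge>0. X t \<omega> = N t \<omega> + A t \<omega>" and \<omega>: "\<omega> \<in> space M"
      and u: "0 \<le> u" "\<forall>v>u. a u \<omega> < a v \<omega>"
    \<comment> \<open>From \<open>U\<close> on the path \<open>a\<close> is constant, so a point of
      increase of \<open>a\<close> precedes \<open>U\<close>; before \<open>U\<close> the stopped
      and original processes coincide.\<close>
    have uU: "u < U \<omega>"
    proof (rule ccontr)
      assume "\<not> u < U \<omega>"
      then have "a (u + 1) \<omega> = a u \<omega>" by (simp add: a_def)
      then show False using u(2)[rule_format, of "u + 1"] by simp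
    qed
    have "A u \<omega> < A v \<omega>" if "u < v" for v
    proof -
      have "A u \<omega> < A (min (U \<omega>) v) \<omega>" using u(2)[rule_format, OF that] uU by (simp add: a_def min_absorb2)
      also have "\<dots> \<le> A v \<omega>" using u that U(2)[OF \<omega>]
        by (intro path_mono[OF A'(2)[OF \<omega>] A'(3)[OF \<omega>]]) auto
      finally show ?thesis .
    qed
    then have "X u \<omega> = 0"
      by (intro carried_increase_imp_zero[OF A'(2)[OF \<omega>] A'(3)[OF \<omega>] c X(2)[OF \<omega>] u(1)])
    then show "L u \<omega> + a u \<omega> = 0" using eq u uU by (simp add: L_def a_def stopped_def min_absorb2)
  qed
  have "bounded (f ` {0..n})" using f(2) by (simp add: locally_bounded_def)
  then obtain k where k: "\<forall>z\<in>{0..n}. \<bar>f z\<bar> \<le> k" by (auto simp: bounded_iff)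
  define g where "g z = indicator {0..n} z * f z" for z
  have gm: "g \<in> borel_measurable borel" unfolding g_def by measurable
  have gk: "\<bar>g z\<bar> \<le> max 0 k" for z
    using k[rule_format, of z] by (simp add: g_def indicator_def le_max_iff_disj)
  note T = transform_martingale_bounded[OF L Lr a ac am a0 an zero gm gk]
  show ?thesis
  proof (rule martingale_cong_AE[OF T])
    show "adapted F (stopped U (\<lambda>t \<omega>. (LBINT z=0..A t \<omega>. f z) - f (A t \<omega>) * X t \<omega>))"
    proof (rule stopped_adapted[OF U(1)])
      fix t :: real assume t: "0 \<le> t"
      note [measurable] = aM[OF t] XM[OF t]
      \<comment> \<open>Here \<open>f\<close> and the signed integral are kept, because replacing
        them by \<open>g\<close> and \<open>transform\<close> is justified only almost everywhere
        and would lose adaptedness.\<close>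
      have "(\<lambda>\<omega>. (LBINT z:{0..a t \<omega>}. f z) - (LBINT z:{a t \<omega>..0}. f z) - f (a t \<omega>) * X (min (U \<omega>) t) \<omega>)
          \<in> borel_measurable (F t)"
        by (intro borel_measurable_diff measurable_Icc_integral) measurable
      then show "(\<lambda>\<omega>. (LBINT z=0..A (min (U \<omega>) t) \<omega>. f z) - f (A (min (U \<omega>) t) \<omega>) * X (min (U \<omega>) t) \<omega>)
          \<in> borel_measurable (F t)"
        by (simp add: interval_integral_eq_Icc a_def)
    qed
    fix t :: real assume t: "0 \<le> t"
    show "AE \<omega> in M. stopped U (\<lambda>t \<omega>. (LBINT z=0..A t \<omega>. f z) - f (A t \<omega>) * X t \<omega>) t \<omega>
        = transform g (\<lambda>t \<omega>. L t \<omega> + a t \<omega>) a t \<omega>"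
      using A(2) an XNA AE_space
    proof eventually_elim
      case (elim \<omega>)
      have U0: "0 \<le> U \<omega>" using U(2) elim by simp
      have "A 0 \<omega> \<le> a t \<omega>"
        unfolding a_def using U0 t elim by (intro path_mono[OF A'(2) A'(3)]) auto
      then have at: "0 \<le> a t \<omega>" "a t \<omega> \<le> n" using elim t by auto
      show ?case
      proof (cases "0 < U \<omega>")
        case True
        have "(LBINT z=0..a t \<omega>. f z) = (LBINT z:{0..a t \<omega>}. g z)"
          using at by (auto simp: interval_integral_eq_Icc_nonneg g_def intro!: set_lebesgue_integral_cong)
        moreover have "g (a t \<omega>) = f (a t \<omega>)" using at by (simp add: g_def)
        moreover have "X (min (U \<omega>) t) \<omega> = L t \<omega> + a t \<omega>"
          using elim True t by (simp add: L_def a_def stopped_def)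
        ultimately show ?thesis using True by (simp add: stopped_def transform_def a_def)
      next
        case False
        \<comment> \<open>On \<open>{U = 0}\<close> the cutoff yields \<open>0\<close>, and so does
          the transform: \<open>a\<close>, \<open>L\<close> and the integral over a single point all
          vanish.\<close>
        then have "a t \<omega> = 0" using U0 t elim by (simp add: a_def)
        moreover have "(LBINT z:{0..0}. g z) = 0"
          using abs_Icc_integral_le[of g 0 0 "max 0 k"] gm gk by simp
        ultimately show ?thesis using False by (simp add: stopped_def transform_def L_def)
      qed
    qed
  qed
qed

lemma class_Sigma_imp_transform_property:
  assumes X: "adapted F X" "\<And>\<omega>. \<omega> \<in> space M \<Longrightarrow> cadlag (\<lambda>t. X t \<omega>)"
    and DM: "Doob_Meyer_decomposition M F X N A"
    and carried: "AE \<omega> in M. AE t in path_measure (\<lambda>t. A t \<omega>). 0 \<le> t \<longrightarrow> X t \<omega> = 0"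
  shows "martingale_transform_property M F X A"
  unfolding martingale_transform_property_def
proof (intro ballI impI)
  fix f :: "real \<Rightarrow> real" assume f[measurable]: "f \<in> borel_measurable borel" and lb: "locally_bounded f"
  note D = Doob_Meyer_decompositionD[OF DM]
  note A = continuous_increasing_processD[OF D(4)]
  obtain T where T: "localizing_sequence M F T" "\<And>n. martingale M F (stopped (T n) N)"
    and N: "adapted F N" "AE_right_continuous N" "AE \<omega> in M. N 0 \<omega> = 0"
    using local_martingale_null_at_0E[OF D(2)] by metis
  let ?Y = "\<lambda>t \<omega>. (LBINT z=0..A t \<omega>. f z) - f (A t \<omega>) * X t \<omega>"
  have ad: "adapted F ?Y"
    unfolding adapted_def
  proof (intro allI impI)
    fix t :: real assume t: "0 \<le> t"
    note [measurable] = adaptedD[OF X(1) t] adaptedD[OF A(1) t]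
    show "?Y t \<in> borel_measurable (F t)"
      unfolding interval_integral_eq_Icc
      by (intro borel_measurable_diff measurable_Icc_integral) measurable
  qed
  \<comment> \<open>Since \<open>f\<close> may be discontinuous, regularity of the product
    \<open>f(A) X\<close> rests on \<open>dA\<close> being carried by the zeros of
    \<open>X\<close>.\<close>
  have cad: "AE \<omega> in M. cadlag (\<lambda>t. ?Y t \<omega>)"
    using D(5) carried AE_space
  proof eventually_elim
    case (elim \<omega>)
    note A' = A(2)[OF elim(3)] A(3)[OF elim(3)]
    have pos: "0 \<le> A t \<omega>" if "0 \<le> t" for t using path_mono[OF A', of 0 t] that elim by simp
    have "cadlag (\<lambda>t. LBINT z:{0..A t \<omega>}. f z)"
      by (rule continuous_on_imp_cadlag, rule continuous_on_compose2[OF continuous_on_Icc_integral[OF f lb] A'(1)])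
        (use pos in auto)
    moreover have "cadlag (\<lambda>t. f (A t \<omega>) * X t \<omega>)"
      by (rule cadlag_comp_mult[OF A' elim(2) X(2)[OF elim(3)] lb])
    ultimately have "cadlag (\<lambda>t. (LBINT z:{0..A t \<omega>}. f z) - f (A t \<omega>) * X t \<omega>)" by (rule cadlag_diff)
    then show ?case
      by (subst cadlag_cong[where y="\<lambda>t. (LBINT z:{0..A t \<omega>}. f z) - f (A t \<omega>) * X t \<omega>"])
        (use pos in \<open>auto simp: interval_integral_eq_Icc_nonneg\<close>)
  qed
  have null: "AE \<omega> in M. ?Y 0 \<omega> = 0"
    using D(1,5) N(3) by eventually_elim (auto simp: zero_ereal_def[symmetric])
  \<comment> \<open>\<open>T\<close> makes \<open>N\<close> a martingale and \<open>S\<close> bounds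
    \<open>A\<close>; their minimum achieves both.\<close>
  define S where "S n \<omega> = strict_level_time (\<lambda>t. A t \<omega>) (real n) (real n)" for n \<omega>
  have S: "localizing_sequence M F S"
    unfolding S_def by (rule localizing_sequence_level[OF D(4)])
  note U = localizing_sequence_min[OF T(1) S]
  have "martingale M F (stopped (\<lambda>\<omega>. min (T n \<omega>) (S n \<omega>)) ?Y)" for n
  proof (rule stopped_martingale_transform[OF _ N(2,3) localizing_sequenceD(1,2)[OF U] D(4,5) _ X D(1) carried f lb])
    show "martingale M F (stopped (\<lambda>\<omega>. min (T n \<omega>) (S n \<omega>)) N)"
      by (rule martingale_stopped_min[OF T(2) N(2,3) localizing_sequenceD(2)[OF T(1)] localizing_sequenceD(1,2)[OF S]])
        (auto intro!: stopped_adapted_cadlag localizing_sequenceD(1,2)[OF U] N(1) D(3))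
    show "AE \<omega> in M. \<forall>t\<ge>0. t \<le> min (T n \<omega>) (S n \<omega>) \<longrightarrow> A t \<omega> \<le> real n"
      using D(5) AE_space
    proof eventually_elim
      case (elim \<omega>)
      then show ?case
        using le_strict_level_time[OF A(2)[OF elim(2)] A(3)[OF elim(2)], of _ "real n" "real n"]
        by (auto simp: S_def)
    qed
  qed
  then show "local_martingale_null_at_0 M F ?Y"
    using ad cad null U unfolding local_martingale_null_at_0_def local_martingale_def by blast
qed

section \<open>From the transform property to the class\<close>

lemma locally_bounded_monotone: "mono f \<Longrightarrow> locally_bounded f"
  unfolding locally_bounded_def
proof (intro allI impI)
  fix K :: "real set" assume f: "mono f" and "compact K"
  then obtain b where b: "\<And>z. z \<in> K \<Longrightarrow> \<bar>z\<bar> \<le> b"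
    using compact_imp_bounded[of K] unfolding bounded_iff real_norm_def by blast
  have "f ` K \<subseteq> {f (- b)..f b}"
    using b monoD[OF f] by (force simp: abs_le_iff)
  then show "bounded (f ` K)" by (rule bounded_subset[OF bounded_closed_interval])
qed

text \<open>All test functions of the converse (the constant 1, the identity, the indicators of
  \<open>{q<..}\<close>) are monotone, and monotonicity gives Borel measurability and local
  boundedness at once.\<close>

lemma transform_propertyD:
  assumes "martingale_transform_property M F X C" "mono f"
  shows "local_martingale_null_at_0 M F (\<lambda>t \<omega>. (LBINT z=0..C t \<omega>. f z) - f (C t \<omega>) * X t \<omega>)"
  using assms locally_bounded_monotone borel_measurable_mono unfolding martingale_transform_property_def by blast

lemma transform_property_const:
  assumes "martingale_transform_property M F X C"
  shows "local_martingale_null_at_0 M F (\<lambda>t \<omega>. C t \<omega> - X t \<omega>)"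
  using transform_propertyD[OF assms, of "\<lambda>_. 1"]
  by (simp add: mono_def zero_ereal_def interval_integral_const(2)[of 0, unfolded zero_ereal_def[symmetric]])

text \<open>The constant 1 gives \<open>C 0 = X 0\<close>; with this the identity gives
  \<open>C 0\<^sup>2 / 2 - C 0\<^sup>2 = 0\<close>.\<close>

lemma transform_property_null_at_0:
  assumes "martingale_transform_property M F X C"
  shows "AE \<omega> in M. C 0 \<omega> = 0"
proof -
  have int: "(LBINT z=0..c. z) = c\<^sup>2 / 2" for c :: real
  proof -
    have "(LBINT z=ereal 0..ereal c. z) = c\<^sup>2 / 2 - 0\<^sup>2 / 2"
      by (rule interval_integral_FTC_finite[where F="\<lambda>z. z\<^sup>2 / 2"])
        (auto intro!: continuous_intros derivative_eq_intros simp: has_real_derivative_iff_has_vector_derivative[symmetric])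
    then show ?thesis by (simp add: zero_ereal_def)
  qed
  have "AE \<omega> in M. (LBINT z=0..C 0 \<omega>. z) - C 0 \<omega> * X 0 \<omega> = 0"
    using transform_propertyD[OF assms, of "\<lambda>z. z"]
    by (auto simp: mono_def local_martingale_null_at_0_def)
  moreover have "AE \<omega> in M. C 0 \<omega> - X 0 \<omega> = 0"
    using transform_property_const[OF assms] by (simp add: local_martingale_null_at_0_def)
  ultimately show ?thesis
    by eventually_elim (simp add: int power2_eq_square)
qed

lemma local_martingale_null_at_0_uminus:
  assumes Y: "local_martingale_null_at_0 M F Y"
  shows "local_martingale_null_at_0 M F (\<lambda>t \<omega>. - Y t \<omega>)"
proof -
  obtain T where T: "localizing_sequence M F T" "\<And>n. martingale M F (stopped (T n) Y)"
    and Y: "adapted F Y" "AE \<omega> in M. cadlag (\<lambda>t. Y t \<omega>)" "AE \<omega> in M. Y 0 \<omega> = 0"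
    using local_martingale_null_at_0E[OF Y] by metis
  have "stopped (T n) (\<lambda>t \<omega>. - Y t \<omega>) = (\<lambda>t \<omega>. - 1 * stopped (T n) Y t \<omega>)" for n
    by (auto simp: stopped_def fun_eq_iff)
  then have "martingale M F (stopped (T n) (\<lambda>t \<omega>. - Y t \<omega>))" for n
    using martingale_cmult[OF T(2), of "-1" n] by simp
  moreover have "AE \<omega> in M. cadlag (\<lambda>t. - Y t \<omega>)"
    using Y(2)
  proof eventually_elim
    case (elim \<omega>)
    have "cadlag (\<lambda>t. 0 - Y t \<omega>)"
      by (rule cadlag_diff[OF continuous_on_imp_cadlag elim]) simp
    then show ?case by simp
  qed
  moreover have "adapted F (\<lambda>t \<omega>. - Y t \<omega>)" using Y(1) by (auto simp: adapted_def)
  ultimately show ?thesis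
    using T(1) Y(3) unfolding local_martingale_null_at_0_def local_martingale_def by auto
qed

lemma transform_property_imp_Doob_Meyer:
  assumes X: "\<And>\<omega>. \<omega> \<in> space M \<Longrightarrow> cadlag (\<lambda>t. X t \<omega>)"
    and C: "continuous_increasing_process M F C" and P: "martingale_transform_property M F X C"
  shows "Doob_Meyer_decomposition M F X (\<lambda>t \<omega>. X t \<omega> - C t \<omega>) C"
  unfolding Doob_Meyer_decomposition_def
proof (intro conjI ballI)
  show "local_martingale_null_at_0 M F (\<lambda>t \<omega>. X t \<omega> - C t \<omega>)"
    using local_martingale_null_at_0_uminus[OF transform_property_const[OF P]] by simp
  show "cadlag (\<lambda>t. X t \<omega> - C t \<omega>)" if "\<omega> \<in> space M" for \<omega>
    using X[OF that] continuous_on_imp_cadlag[OF continuous_increasing_processD(2)[OF C that]]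
    by (rule cadlag_diff)
qed (auto simp: C transform_property_null_at_0[OF P])

text \<open>
  Only path regularity is needed here: for \<open>f = indicator {q<..}\<close>, right-continuity of the transform
  at the last time \<open>C\<close> is at level \<open>q\<close> forces \<open>X\<close> to vanish there.
\<close>

lemma transform_property_imp_carried:
  assumes X: "\<And>\<omega>. \<omega> \<in> space M \<Longrightarrow> cadlag (\<lambda>t. X t \<omega>)"
    and C: "continuous_increasing_process M F C" and P: "martingale_transform_property M F X C"
  shows "AE \<omega> in M. AE t in path_measure (\<lambda>t. C t \<omega>). 0 \<le> t \<longrightarrow> X t \<omega> = 0"
proof -
  note C' = continuous_increasing_processD[OF C]
  define f where "f q z = (indicator {q<..} z :: real)" for q z :: real
  have f: "mono (f q)" for q by (auto simp: f_def mono_def indicator_def)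
  \<comment> \<open>Restricting to rational levels lets a single null set serve all of them.\<close>
  have "AE \<omega> in M. \<forall>q\<in>\<rat>. cadlag (\<lambda>t. (LBINT z=0..C t \<omega>. f q z) - f q (C t \<omega>) * X t \<omega>)"
    unfolding AE_ball_countable[OF countable_rat] using transform_propertyD[OF P f]
    by (simp add: local_martingale_null_at_0_def local_martingale_def)
  then show ?thesis
    using transform_property_null_at_0[OF P] AE_space
  proof eventually_elim
    case (elim \<omega>)
    note Cw = C'(2)[OF elim(3)] C'(3)[OF elim(3)]
    have pos: "0 \<le> C t \<omega>" if "0 \<le> t" for t using path_mono[OF Cw, of 0 t] that elim by simp
    have "((\<lambda>t. indicator {q<..} (C t \<omega>) * X t \<omega>) \<longlongrightarrow> indicator {q<..} (C u \<omega>) * X u \<omega>) (at_right u)"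
      if q: "q \<in> \<rat>" and u: "0 \<le> u" for q u
    proof -
      \<comment> \<open>The primitive of \<open>f q\<close> is continuous along \<open>C\<close>;
        subtracting the transform from it isolates the product \<open>f q (C) X\<close>.\<close>
      have "cadlag (\<lambda>t. LBINT z:{0..C t \<omega>}. f q z)"
        by (rule continuous_on_imp_cadlag, rule continuous_on_compose2[OF continuous_on_Icc_integral Cw(1)])
          (use pos f in \<open>auto intro: borel_measurable_mono locally_bounded_monotone\<close>)
      then have "cadlag (\<lambda>t. LBINT z=0..C t \<omega>. f q z)"
        by (subst cadlag_cong[where y="\<lambda>t. LBINT z:{0..C t \<omega>}. f q z"])
          (use pos in \<open>auto simp: interval_integral_eq_Icc_nonneg\<close>)
      from cadlag_diff[OF this elim(1)[rule_format, OF q]]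
      have "cadlag (\<lambda>t. f q (C t \<omega>) * X t \<omega>)" by simp
      from cadlag_right[OF this u] show ?thesis by (simp add: f_def)
    qed
    then have "\<exists>v>t. C v \<omega> = C t \<omega>" if "0 \<le> t" "X t \<omega> \<noteq> 0" for t
      using right_limits_imp_constant[OF Cw X[OF elim(3)] elim(2) _ that] by blast
    then show ?case by (rule path_measure_carriedI[OF Cw])
  qed
qed

text \<open>The difference of the two martingale parts is \<open>C - A\<close>, a difference of
  continuous increasing processes, which becomes a bounded martingale after localization.\<close>

lemma Doob_Meyer_unique:
  assumes DM: "Doob_Meyer_decomposition M F X N A" "Doob_Meyer_decomposition M F X N' C"
  shows "AE \<omega> in M. \<forall>t\<ge>0. C t \<omega> = A t \<omega>"
proof -
  note D = Doob_Meyer_decompositionD[OF DM(1)]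
  note D' = Doob_Meyer_decompositionD[OF DM(2)]
  note A = continuous_increasing_processD[OF D(4)]
  note C = continuous_increasing_processD[OF D'(4)]
  obtain T where T: "localizing_sequence M F T" "\<And>n. martingale M F (stopped (T n) N)"
    and N: "adapted F N" "AE_right_continuous N" "AE \<omega> in M. N 0 \<omega> = 0"
    using local_martingale_null_at_0E[OF D(2)] by metis
  obtain T' where T': "localizing_sequence M F T'" "\<And>n. martingale M F (stopped (T' n) N')"
    and N': "adapted F N'" "AE_right_continuous N'" "AE \<omega> in M. N' 0 \<omega> = 0"
    using local_martingale_null_at_0E[OF D'(2)] by metis
  \<comment> \<open>One level time of the sum bounds both \<open>A\<close> and \<open>C\<close>, as
    both are almost surely nonnegative.\<close>
  have V: "continuous_increasing_process M F (\<lambda>t \<omega>. A t \<omega> + C t \<omega>)"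
    using A C unfolding continuous_increasing_process_def
    by (auto simp: adapted_def mono_on_def intro!: continuous_intros add_mono borel_measurable_add)
  note V' = continuous_increasing_processD[OF V]
  define S where "S n \<omega> = strict_level_time (\<lambda>t. A t \<omega> + C t \<omega>) (real n) (real n)" for n \<omega>
  have S: "localizing_sequence M F S"
    unfolding S_def by (rule localizing_sequence_level[OF V])
  define U where "U n \<omega> = min (T n \<omega>) (min (T' n \<omega>) (S n \<omega>))" for n \<omega>
  \<comment> \<open>\<open>martingale_stopped_min\<close> expects the localizing time of the
    martingale in question first, which is \<open>T n\<close> for \<open>N\<close> and
    \<open>T' n\<close> for \<open>N'\<close>.\<close>
  have U': "U n = (\<lambda>\<omega>. min (T' n \<omega>) (min (T n \<omega>) (S n \<omega>)))" for n
    by (auto simp: U_def min.left_commute)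
  have U: "localizing_sequence M F U"
    unfolding U_def by (intro localizing_sequence_min T T' S)
  have mN: "martingale M F (stopped (U n) N)" for n
  proof -
    note R = localizing_sequence_min[OF T'(1) S]
    show ?thesis
      unfolding U_def
      by (rule martingale_stopped_min[OF T(2) N(2,3) localizing_sequenceD(2)[OF T(1)] localizing_sequenceD(1,2)[OF R]])
        (auto intro!: stopped_adapted_cadlag localizing_sequenceD(1,2)[OF U, unfolded U_def] N(1) D(3))
  qed
  have mN': "martingale M F (stopped (U n) N')" for n
  proof -
    note R = localizing_sequence_min[OF T(1) S]
    show ?thesis
      unfolding U'
      by (rule martingale_stopped_min[OF T'(2) N'(2,3) localizing_sequenceD(2)[OF T'(1)] localizing_sequenceD(1,2)[OF R]])
        (auto intro!: stopped_adapted_cadlag localizing_sequenceD(1,2)[OF U, unfolded U'] N'(1) D'(3))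
  qed
  have eqU: "AE \<omega> in M. C (min (U n \<omega>) t) \<omega> = A (min (U n \<omega>) t) \<omega>" if t: "0 \<le> t" for n t
  proof -
    have "AE \<omega> in M. C 0 \<omega> = 0 \<and> A 0 \<omega> = 0 \<and> (\<forall>t\<ge>0. stopped (U n) N t \<omega> + - 1 * stopped (U n) N' t \<omega>
        = C (min (U n \<omega>) t) \<omega> - A (min (U n \<omega>) t) \<omega>)"
      using D(1) D'(1) D(5) D'(5) AE_space
    proof eventually_elim
      case (elim \<omega>)
      have U0: "0 \<le> U n \<omega>" by (rule localizing_sequenceD(2)[OF U elim(5)])
      have "N u \<omega> - N' u \<omega> = C u \<omega> - A u \<omega>" if "0 \<le> u" for u
        using elim(1,2) that by (smt (verit))
      \<comment> \<open>On \<open>{U n = 0}\<close> the cutoff makes the left side \<open>0\<close>,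
        and the right side is \<open>C 0 - A 0 = 0\<close>.\<close>
      then show ?case
        using elim U0 by (cases "0 < U n \<omega>") (auto simp: stopped_def)
    qed note dec = this
    have "AE \<omega> in M. stopped (U n) N t \<omega> + - 1 * stopped (U n) N' t \<omega> = 0"
    proof (rule continuous_finite_variation_martingale[OF martingale_add[OF mN martingale_cmult[OF mN']] _ _ t])
      show "AE \<omega> in M. \<exists>p q. continuous_on {0..} p \<and> continuous_on {0..} q \<and> mono_on {0..} p \<and> mono_on {0..} q \<and>
        (\<forall>t\<ge>0. 0 \<le> p t \<and> p t \<le> real n \<and> 0 \<le> q t \<and> q t \<le> real n \<and>
          stopped (U n) N t \<omega> + - 1 * stopped (U n) N' t \<omega> = p t - q t)"
        using dec AE_space
      proof eventually_elim
        case (elim \<omega>)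
        note Aw = A(2)[OF elim(2)] A(3)[OF elim(2)]
        note Cw = C(2)[OF elim(2)] C(3)[OF elim(2)]
        have U0: "0 \<le> U n \<omega>" by (rule localizing_sequenceD(2)[OF U elim(2)])
        define p where "p t = C (min (U n \<omega>) t) \<omega>" for t
        define q where "q t = A (min (U n \<omega>) t) \<omega>" for t
        have "continuous_on {0..} p" "continuous_on {0..} q"
          unfolding p_def q_def
          by (rule continuous_on_compose2[OF Cw(1)] continuous_on_compose2[OF Aw(1)];
              use U0 in \<open>auto intro!: continuous_intros\<close>)+
        moreover have "mono_on {0..} p" "mono_on {0..} q"
          unfolding p_def q_def using U0 by (auto intro!: mono_onI path_mono[OF Cw] path_mono[OF Aw])
        moreover have "0 \<le> p t \<and> p t \<le> real n \<and> 0 \<le> q t \<and> q t \<le> real n" if t: "0 \<le> t" for t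
        proof -
          have u: "0 \<le> min (U n \<omega>) t" "min (U n \<omega>) t \<le> S n \<omega>" using U0 t by (auto simp: U_def)
          have "A (min (U n \<omega>) t) \<omega> + C (min (U n \<omega>) t) \<omega> \<le> real n"
            using le_strict_level_time[OF V'(2)[OF elim(2)] V'(3)[OF elim(2)] u(1), of "real n" "real n"] u(2) elim(1)
            by (simp add: S_def)
          moreover have "0 \<le> A (min (U n \<omega>) t) \<omega>" "0 \<le> C (min (U n \<omega>) t) \<omega>"
            using path_mono[OF Aw _ u(1)] path_mono[OF Cw _ u(1)] elim(1) by force+
          ultimately show ?thesis by (simp add: p_def q_def)
        qed
        ultimately show ?case using elim(1) by (intro exI[of _ p] exI[of _ q]) (auto simp: p_def q_def)
      qed
      show "AE \<omega> in M. stopped (U n) N 0 \<omega> + - 1 * stopped (U n) N' 0 \<omega> = 0"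
        using dec AE_space
      proof eventually_elim
        case (elim \<omega>)
        then show ?case using localizing_sequenceD(2)[OF U elim(2), of n] by (simp add: min_absorb2)
      qed
    qed
    then show ?thesis using dec by eventually_elim (use t in auto)
  qed
  \<comment> \<open>Countably many \<open>q\<close> and \<open>n\<close> share one null set. Off it,
    and where the localizing times tend to infinity, some \<open>U n\<close> passes any given
    \<open>q\<close>, and right-continuity extends the equality from rational to real times.\<close>
  have "AE \<omega> in M. \<forall>q\<in>\<rat> \<inter> {0..}. \<forall>n. C (min (U n \<omega>) q) \<omega> = A (min (U n \<omega>) q) \<omega>"
    using eqU by (subst AE_ball_countable) (auto simp: AE_all_countable intro: countable_subset[OF _ countable_rat])
  then show ?thesis
    using localizing_sequenceD(3)[OF U] AE_space
  proof (eventually_elim, intro allI impI)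
    fix \<omega> t
    assume eq: "\<forall>q\<in>\<rat> \<inter> {0..}. \<forall>n. C (min (U n \<omega>) q) \<omega> = A (min (U n \<omega>) q) \<omega>"
      and lim: "incseq (\<lambda>n. U n \<omega>) \<and> filterlim (\<lambda>n. U n \<omega>) at_top sequentially"
      and \<omega>: "\<omega> \<in> space M" and t: "0 \<le> (t::real)"
    have rat: "C q \<omega> = A q \<omega>" if q: "q \<in> \<rat>" "0 \<le> q" for q
    proof -
      have "\<forall>\<^sub>F n in sequentially. q \<le> U n \<omega>" using lim by (simp add: filterlim_at_top)
      then obtain n where "q \<le> U n \<omega>" by (auto simp: eventually_sequentially)
      then show ?thesis using eq[rule_format, of q n] q by (simp add: min_absorb2)
    qed
    show "C t \<omega> = A t \<omega>"
    proof (rule ccontr)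
      assume "C t \<omega> \<noteq> A t \<omega>"
      then have "C t \<omega> - A t \<omega> \<noteq> 0" by simp
      moreover have "((\<lambda>s. C s \<omega> - A s \<omega>) \<longlongrightarrow> C t \<omega> - A t \<omega>) (at_right t)"
        by (intro tendsto_diff continuous_on_Ici_limits(1)[OF C(2)[OF \<omega>] t] continuous_on_Ici_limits(1)[OF A(2)[OF \<omega>] t])
      ultimately have "\<forall>\<^sub>F s in at_right t. C s \<omega> - A s \<omega> \<noteq> 0" by (rule tendsto_imp_eventually_ne[rotated])
      then obtain v where v: "t < v" "\<And>s. t < s \<Longrightarrow> s < v \<Longrightarrow> C s \<omega> - A s \<omega> \<noteq> 0"
        by (auto simp: eventually_at_right_field)
      obtain q where "q \<in> \<rat>" "t < q" "q < v" using Rats_dense_in_real[OF v(1)] by auto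
      then show False using v(2)[of q] rat[of q] t by simp
    qed
  qed
qed

end

theorem theorem2p1:
  fixes M :: "'a measure" and F :: "real \<Rightarrow> 'a measure" and X :: "real \<Rightarrow> 'a \<Rightarrow> real"
  assumes "filtered_prob_space M F"
    and "local_submartingale M F X"
    and "\<forall>\<omega>\<in>space M. cadlag (\<lambda>t. X t \<omega>)"
    and "AE \<omega> in M. \<forall>t\<ge>0. 0 \<le> X t \<omega>"
  shows "(class_Sigma M F X \<longleftrightarrow>
            (\<exists>C. continuous_increasing_process M F C \<and> martingale_transform_property M F X C))
       \<and> (class_Sigma M F X \<longrightarrow>
            (\<forall>N A C. Doob_Meyer_decomposition M F X N A \<longrightarrow>
               continuous_increasing_process M F C \<longrightarrow> martingale_transform_property M F X C \<longrightarrow>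
               (AE \<omega> in M. \<forall>t\<ge>0. C t \<omega> = A t \<omega>)))"
proof -
  interpret filtered_prob_space M F by (rule assms(1))
  have X: "adapted F X" "\<And>\<omega>. \<omega> \<in> space M \<Longrightarrow> cadlag (\<lambda>t. X t \<omega>)"
    using assms(2,3) by (auto simp: local_submartingale_def)
  show ?thesis
  proof (intro conjI iffI impI allI)
    assume "class_Sigma M F X"
    then obtain N A where DM: "Doob_Meyer_decomposition M F X N A"
      and carried: "AE \<omega> in M. AE t in path_measure (\<lambda>t. A t \<omega>). 0 \<le> t \<longrightarrow> X t \<omega> = 0"
      unfolding class_Sigma_def by blast
    from class_Sigma_imp_transform_property[OF X DM carried]
    show "\<exists>C. continuous_increasing_process M F C \<and> martingale_transform_property M F X C"
      using Doob_Meyer_decompositionD(4)[OF DM] by blast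
  next
    assume "\<exists>C. continuous_increasing_process M F C \<and> martingale_transform_property M F X C"
    then obtain C where C: "continuous_increasing_process M F C" "martingale_transform_property M F X C"
      by blast
    show "class_Sigma M F X"
      unfolding class_Sigma_def
      using assms(2,4) transform_property_imp_Doob_Meyer[OF X(2) C] transform_property_imp_carried[OF X(2) C]
      by blast
  next
    fix N A C
    assume "Doob_Meyer_decomposition M F X N A"
      "continuous_increasing_process M F C" "martingale_transform_property M F X C"
    \<comment> \<open>\<open>C\<close> is itself the increasing part of a decomposition of
      \<open>X\<close>, so only uniqueness of the decomposition is left.\<close>
    note this(1) transform_property_imp_Doob_Meyer[OF X(2) this(2,3)]
    then show "AE \<omega> in M. \<forall>t\<ge>0. C t \<omega> = A t \<omega>" by (rule Doob_Meyer_unique)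
  qed
qed

end
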